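(* Let $n,r$ be positive integers with $n(r+1)$ even, and let $G=K_{n,\ldots,n,n+1}$ be the complete $(r+1)$-partite graph with $r$ parts of size $n$ and one part of size $n+1$. Then $$\frac{n(r-1)}{2}\leq \mathrm{def}(G)\leq \frac{n(r-1)}{2}+1.$$
   Context: A complete $(r+1)$-partite graph has its vertex set partitioned into $r+1$ nonempty independent sets with every two vertices in different parts adjacent. For a proper edge-coloring $\alpha$ of a graph $G$ (with positive integer colors) and a vertex $v$, let $S(v,\alpha)$ be the set of colors on edges incident to $v$, and $\mathrm{def}(v,\alpha)=\max S(v,\alpha)-\min S(v,\alpha)-|S(v,\alpha)|+1$. The deficiency of $G$ is $\mathrm{def}(G)=\min_\alpha \sum_{v\in V(G)}\mathrm{def}(v,\alpha)$ over all proper edge-colorings $\alpha$ of $G$; equivalently, the minimum number of pendant edges whose attachment to $G$ yields a graph admitting an interval coloring (a proper edge-coloring with colors $1,\ldots,t$, all used, in which every vertex's color set is an integer interval). *)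

theory Defs
  imports Complex_Main "HOL-Library.Disjoint_Sets"
begin

definition simple_graph :: "'a set \<Rightarrow> 'a set set \<Rightarrow> bool" where
  "simple_graph V E \<longleftrightarrow> finite V \<and> (\<forall>e\<in>E. e \<subseteq> V \<and> card e = 2)"

text \<open>The parts are indexed by \<open>0, \<dots>, k - 1\<close>; values of \<open>P\<close> at other indices play no role.\<close>

definition complete_multipartite ::
    "'a set \<Rightarrow> 'a set set \<Rightarrow> nat \<Rightarrow> (nat \<Rightarrow> 'a set) \<Rightarrow> bool" where
  "complete_multipartite V E k P \<longleftrightarrow>
     simple_graph V E \<and>
     V = (\<Union>i<k. P i) \<and> disjoint_family_on P {..<k} \<and> (\<forall>i<k. P i \<noteq> {}) \<and>
     (\<forall>i<k. \<forall>u\<in>P i. \<forall>v\<in>P i. {u, v} \<notin> E) \<and>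
     (\<forall>i<k. \<forall>j<k. i \<noteq> j \<longrightarrow> (\<forall>u\<in>P i. \<forall>v\<in>P j. {u, v} \<in> E))"

text \<open>Values of a coloring outside the edge set play no role.\<close>

definition proper_edge_coloring :: "'a set set \<Rightarrow> ('a set \<Rightarrow> nat) \<Rightarrow> bool" where
  "proper_edge_coloring E \<alpha> \<longleftrightarrow>
     (\<forall>e\<in>E. \<alpha> e > 0) \<and>
     (\<forall>e\<in>E. \<forall>f\<in>E. e \<noteq> f \<and> e \<inter> f \<noteq> {} \<longrightarrow> \<alpha> e \<noteq> \<alpha> f)"

definition vertex_colors :: "'a set set \<Rightarrow> ('a set \<Rightarrow> nat) \<Rightarrow> 'a \<Rightarrow> nat set" where
  "vertex_colors E \<alpha> v = \<alpha> ` {e \<in> E. v \<in> e}"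

text \<open>An isolated vertex has no maximal or minimal color; its deficiency is taken to be 0.\<close>

definition vertex_deficiency :: "'a set set \<Rightarrow> ('a set \<Rightarrow> nat) \<Rightarrow> 'a \<Rightarrow> int" where
  "vertex_deficiency E \<alpha> v =
     (let S = vertex_colors E \<alpha> v
      in if S = {} then 0 else int (Max S) - int (Min S) - int (card S) + 1)"

definition coloring_deficiency :: "'a set \<Rightarrow> 'a set set \<Rightarrow> ('a set \<Rightarrow> nat) \<Rightarrow> int" where
  "coloring_deficiency V E \<alpha> = (\<Sum>v\<in>V. vertex_deficiency E \<alpha> v)"

text \<open>For a simple graph this least value exists, by the two lemmas
  \<open>deficiency_attained\<close> and \<open>deficiency_le\<close> below.\<close>

definition deficiency :: "'a set \<Rightarrow> 'a set set \<Rightarrow> int" where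
  "deficiency V E =
     (LEAST d. \<exists>\<alpha>. proper_edge_coloring E \<alpha> \<and> d = coloring_deficiency V E \<alpha>)"

lemma simple_graph_finite_edges:
  assumes "simple_graph V E"
  shows "finite E"
proof -
  have "E \<subseteq> Pow V" "finite (Pow V)"
    using assms by (auto simp: simple_graph_def)
  then show ?thesis
    by (rule finite_subset)
qed

lemma ex_proper_edge_coloring:
  assumes "simple_graph V E"
  shows "\<exists>\<alpha>. proper_edge_coloring E \<alpha>"
proof -
  obtain f :: "'a set \<Rightarrow> nat" where f: "inj_on f E"
    using finite_imp_inj_to_nat_seg[OF simple_graph_finite_edges[OF assms]] by blast
  have "proper_edge_coloring E (\<lambda>e. Suc (f e))"
    using f by (auto simp: proper_edge_coloring_def inj_on_def)
  then show ?thesis by blast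
qed

lemma vertex_deficiency_nonneg:
  assumes "finite E"
  shows "vertex_deficiency E \<alpha> v \<ge> 0"
proof (cases "vertex_colors E \<alpha> v = {}")
  case True
  then show ?thesis by (simp add: vertex_deficiency_def)
next
  case False
  let ?S = "vertex_colors E \<alpha> v"
  have fin: "finite ?S"
    using assms by (simp add: vertex_colors_def)
  have "?S \<subseteq> {Min ?S..Max ?S}"
    using fin by auto
  then have "card ?S \<le> card {Min ?S..Max ?S}"
    by (intro card_mono) auto
  moreover have "Min ?S \<le> Max ?S"
    using fin False by simp
  ultimately show ?thesis
    using False by (simp add: vertex_deficiency_def Let_def)
qed

lemma coloring_deficiency_nonneg:
  assumes "simple_graph V E"
  shows "coloring_deficiency V E \<alpha> \<ge> 0"
  unfolding coloring_deficiency_def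
  by (intro sum_nonneg vertex_deficiency_nonneg simple_graph_finite_edges[OF assms])

lemma deficiency_is_minimum:
  assumes "simple_graph V E"
  shows "\<exists>\<alpha>. proper_edge_coloring E \<alpha> \<and> deficiency V E = coloring_deficiency V E \<alpha> \<and>
    (\<forall>\<beta>. proper_edge_coloring E \<beta> \<longrightarrow> coloring_deficiency V E \<alpha> \<le> coloring_deficiency V E \<beta>)"
proof -
  obtain \<gamma> where "proper_edge_coloring E \<gamma>"
    using ex_proper_edge_coloring[OF assms] by blast
  then obtain \<alpha> where \<alpha>: "proper_edge_coloring E \<alpha>"
    and least: "\<And>\<beta>. proper_edge_coloring E \<beta> \<Longrightarrow>
      nat (coloring_deficiency V E \<alpha>) \<le> nat (coloring_deficiency V E \<beta>)"
    using ex_has_least_nat[of "proper_edge_coloring E" \<gamma> "\<lambda>\<alpha>. nat (coloring_deficiency V E \<alpha>)"]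
    by blast
  have min: "coloring_deficiency V E \<alpha> \<le> coloring_deficiency V E \<beta>"
    if "proper_edge_coloring E \<beta>" for \<beta>
    using least[OF that] coloring_deficiency_nonneg[OF assms, of \<beta>] by linarith
  have "deficiency V E = coloring_deficiency V E \<alpha>"
    unfolding deficiency_def by (rule Least_equality) (use \<alpha> min in auto)
  then show ?thesis
    using \<alpha> min by blast
qed

lemma deficiency_attained:
  assumes "simple_graph V E"
  obtains \<alpha> where "proper_edge_coloring E \<alpha>" "deficiency V E = coloring_deficiency V E \<alpha>"
  using deficiency_is_minimum[OF assms] by blast

lemma deficiency_le:
  assumes "simple_graph V E" "proper_edge_coloring E \<beta>"
  shows "deficiency V E \<le> coloring_deficiency V E \<beta>"
  using deficiency_is_minimum[OF assms(1)] assms(2) by metis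

end

theory Submission imports Defs begin

text \<open>
  Lower bound: delete, for every vertex \<open>v\<close>, the at most \<open>def(v)\<close> edges at \<open>v\<close> whose colour exceeds
  the least colour at \<open>v\<close> by at least \<open>\<Delta> = n r + 1\<close>. Modulo \<open>\<Delta>\<close> the other edges are then properly
  coloured, and as the number of vertices is odd, each of the \<open>\<Delta>\<close> classes has at most
  \<open>n (r + 1) / 2\<close> edges; the total number of edges exceeds \<open>\<Delta> n (r + 1) / 2\<close> by \<open>n (r - 1) / 2\<close>.

  Upper bound: put one vertex of the large part aside (the apex) and split the others into two
  sides labelled \<open>0, \<dots>, p - 1\<close>, \<open>p = n (r + 1) / 2\<close>, cut into groups of consecutive labels. Edges
  inside a side, and edges between groups of the same position, get the sum of the two labels,
  shifted by a constant \<open>D\<close> once the sum reaches \<open>p\<close>; this leaves free the middle colours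
  \<open>p, \<dots>, p + D - 1\<close>, which Koenig's theorem distributes over the other edges between the sides and
  many of the edges at the apex. The remaining edges at the apex extend the colour intervals of their
  other ends. For odd \<open>r\<close> each group is a part and no further deficiency arises. For even \<open>r\<close> a
  part consists of two groups on different sides, and two apex edges compete for one colour; repairing
  this costs the additional \<open>1\<close>.
\<close>

section \<open>The lower bound\<close>

lemma handshake:
  assumes "simple_graph V E"
  shows "(\<Sum>v\<in>V. card {e \<in> E. v \<in> e}) = 2 * card E"
proof -
  have fin: "finite V" "finite E" and E: "\<And>e. e \<in> E \<Longrightarrow> e \<subseteq> V \<and> card e = 2"
    using assms simple_graph_finite_edges by (auto simp: simple_graph_def)
  have "{v \<in> V. v \<in> e} = e" if "e \<in> E" for e
    using E[OF that] by auto
  then have "\<forall>e\<in>E. card {v \<in> V. v \<in> e} = 2"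
    using E by simp
  from sum_multicount[OF fin this] show ?thesis
    by (simp add: mult.commute)
qed

lemma card_matching_le:
  assumes "finite V" "\<And>e. e \<in> M \<Longrightarrow> e \<subseteq> V \<and> card e = 2"
    "\<And>e f. e \<in> M \<Longrightarrow> f \<in> M \<Longrightarrow> e \<noteq> f \<Longrightarrow> e \<inter> f = {}"
  shows "card M \<le> card V div 2"
proof -
  have fin: "finite M"
    using assms(1,2) by (meson PowI finite_Pow_iff finite_subset subsetI)
  have "card (\<Union>M) = (\<Sum>e\<in>M. card e)"
    using assms by (intro card_Union_disjoint) (auto simp: pairwise_def disjnt_def intro: finite_subset)
  also have "\<dots> = 2 * card M"
    using assms(2) by simp
  finally have "2 * card M \<le> card V"
    using card_mono[OF assms(1), of "\<Union>M"] assms(2) by auto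
  then show ?thesis by simp
qed

text \<open>Edges whose colour exceeds the least one at an end by \<open>D\<close> or more are paid
  for by the deficiency, because the degrees are at most \<open>D\<close>. The other edges split
  into \<open>D\<close> matchings, one for each residue modulo \<open>D\<close>.\<close>

lemma card_edges_le_deficiency:
  assumes G: "simple_graph V E" and D: "D > 0" and deg: "\<And>v. v \<in> V \<Longrightarrow> card {e \<in> E. v \<in> e} \<le> D"
  shows "int (card E) \<le> int (D * (card V div 2)) + deficiency V E"
proof -
  obtain \<alpha> where \<alpha>: "proper_edge_coloring E \<alpha>" and d: "deficiency V E = coloring_deficiency V E \<alpha>"
    using deficiency_attained[OF G] .
  have finV: "finite V" and finE: "finite E" and E: "\<And>e. e \<in> E \<Longrightarrow> e \<subseteq> V \<and> card e = 2"
    using G simple_graph_finite_edges by (auto simp: simple_graph_def)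
  define S where "S v = vertex_colors E \<alpha> v" for v
  define X where "X v = {e \<in> E. v \<in> e \<and> \<alpha> e \<ge> Min (S v) + D}" for v
  define F where "F = E - (\<Union>v\<in>V. X v)"
  have inj: "inj_on \<alpha> {e \<in> E. v \<in> e}" for v
    using \<alpha> by (auto simp: proper_edge_coloring_def inj_on_def)
  have finS: "finite (S v)" for v
    using finE by (simp add: S_def vertex_colors_def)
  have inS: "\<alpha> e \<in> S v" if "e \<in> E" "v \<in> e" for e v
    using that by (auto simp: S_def vertex_colors_def)
  have cardX: "int (card (X v)) \<le> vertex_deficiency E \<alpha> v" if "v \<in> V" for v
  proof (cases "X v = {}")
    case True
    then show ?thesis using vertex_deficiency_nonneg[OF finE] by simp
  next
    case False
    then obtain e where e: "e \<in> E" "v \<in> e" "\<alpha> e \<ge> Min (S v) + D" by (auto simp: X_def)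
    have ne: "S v \<noteq> {}" using inS e by auto
    \<comment> \<open>The colours at \<open>v\<close> are distinct, so \<open>card (X v)\<close> is
      at most \<open>Max (S v) - Min (S v) - D + 1\<close>, and \<open>card (S v) \<le> D\<close>
      makes this at most the deficiency of \<open>v\<close>.\<close>
    have "\<alpha> ` X v \<subseteq> {Min (S v) + D..Max (S v)}"
      using finS inS by (auto simp: X_def)
    then have "card (\<alpha> ` X v) \<le> Max (S v) + 1 - (Min (S v) + D)"
      by (metis Suc_eq_plus1 card_atLeastAtMost card_mono finite_atLeastAtMost)
    moreover have "card (\<alpha> ` X v) = card (X v)"
      by (intro card_image inj_on_subset[OF inj[of v]]) (auto simp: X_def)
    moreover have "card (S v) \<le> D"
      using deg[OF that] card_image_le[of "{e \<in> E. v \<in> e}" \<alpha>] finE by (simp add: S_def vertex_colors_def)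
    moreover have "Max (S v) \<ge> Min (S v) + D"
      using e inS[of e v] finS[of v] by (meson Max_ge le_trans)
    ultimately show ?thesis
      using ne by (simp add: vertex_deficiency_def Let_def flip: S_def)
  qed
  have "E \<subseteq> F \<union> (\<Union>v\<in>V. X v)" by (auto simp: F_def)
  then have "card E \<le> card F + card (\<Union>v\<in>V. X v)"
    using finE finV by (intro order_trans[OF card_mono card_Un_le]) (auto simp: F_def X_def)
  also have "\<dots> \<le> card F + (\<Sum>v\<in>V. card (X v))"
    using card_UN_le[OF finV] by simp
  finally have "int (card E) \<le> int (card F) + (\<Sum>v\<in>V. int (card (X v)))"
    by (metis of_nat_add of_nat_le_iff of_nat_sum)
  also have "\<dots> \<le> int (card F) + deficiency V E"
    unfolding d coloring_deficiency_def by (intro add_left_mono sum_mono cardX)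
  finally have 1: "int (card E) \<le> int (card F) + deficiency V E" .
  \<comment> \<open>Both colours lie among the \<open>D\<close> consecutive values from
    \<open>Min (S v)\<close> on, where equal residues mean equal colours; properness at the common
    vertex excludes that.\<close>
  have disj: "e \<inter> f = {}" if "e \<in> F" "f \<in> F" "e \<noteq> f" "\<alpha> e mod D = \<alpha> f mod D" for e f
  proof (rule ccontr)
    assume "e \<inter> f \<noteq> {}"
    then obtain v where v: "v \<in> e" "v \<in> f" by auto
    have ef: "e \<in> E" "f \<in> E" "v \<in> V" using that v E by (auto simp: F_def)
    have ne: "\<alpha> e \<noteq> \<alpha> f" using inj[of v] v ef that by (auto simp: inj_on_def)
    have "\<alpha> e < Min (S v) + D" "\<alpha> f < Min (S v) + D"
      using that ef v by (auto simp: F_def X_def not_le)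
    moreover have "Min (S v) \<le> \<alpha> e" "Min (S v) \<le> \<alpha> f"
      using finS inS ef v by auto
    ultimately have "\<bar>int (\<alpha> e) - int (\<alpha> f)\<bar> < int D" by linarith
    moreover have "int D dvd int (\<alpha> e) - int (\<alpha> f)"
      using that(4) by (metis mod_eq_dvd_iff of_nat_mod)
    ultimately show False
      using ne zdvd_imp_le[of "int D" "\<bar>int (\<alpha> e) - int (\<alpha> f)\<bar>"] by auto
  qed
  have "F = (\<Union>c<D. {e \<in> F. \<alpha> e mod D = c})" using D by auto
  then have "card F \<le> (\<Sum>c<D. card {e \<in> F. \<alpha> e mod D = c})"
    using card_UN_le[of "{..<D}" "\<lambda>c. {e \<in> F. \<alpha> e mod D = c}"] by auto
  also have "\<dots> \<le> (\<Sum>c<D. card V div 2)"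
    by (intro sum_mono card_matching_le[OF finV]) (use E disj in \<open>auto simp: F_def\<close>)
  finally have "card F \<le> D * (card V div 2)" by simp
  then have "int (card F) \<le> int (D * (card V div 2))"
    by (rule of_nat_mono)
  with 1 show ?thesis by linarith
qed

section \<open>Edges and degrees of complete multipartite graphs\<close>

lemma multipartiteD:
  assumes "complete_multipartite V E k P"
  shows "simple_graph V E" "V = (\<Union>i<k. P i)" "disjoint_family_on P {..<k}"
    "\<And>i u v. i < k \<Longrightarrow> u \<in> P i \<Longrightarrow> v \<in> P i \<Longrightarrow> {u, v} \<notin> E"
    "\<And>i j u v. i < k \<Longrightarrow> j < k \<Longrightarrow> i \<noteq> j \<Longrightarrow> u \<in> P i \<Longrightarrow> v \<in> P j \<Longrightarrow> {u, v} \<in> E"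
  using assms unfolding complete_multipartite_def by blast+

lemma multipartite_vertexE:
  assumes "complete_multipartite V E k P" "v \<in> V"
  obtains i where "i < k" "v \<in> P i"
  using assms(2) unfolding multipartiteD(2)[OF assms(1)] by auto

lemma multipartite_finite:
  assumes "complete_multipartite V E k P"
  shows "finite V" "\<And>i. i < k \<Longrightarrow> finite (P i)"
proof -
  show fin: "finite V"
    using multipartiteD(1)[OF assms] by (simp add: simple_graph_def)
  show "finite (P i)" if "i < k" for i
    using that multipartiteD(2)[OF assms] by (intro finite_subset[OF _ fin]) auto
qed

lemma multipartite_edges_at:
  assumes G: "complete_multipartite V E k P" and "i < k" "v \<in> P i"
  shows "{e \<in> E. v \<in> e} = (\<lambda>u. {v, u}) ` (V - P i)"
proof (intro equalityI subsetI)
  fix e assume "e \<in> {e \<in> E. v \<in> e}"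
  then have e: "e \<in> E" "v \<in> e" "e \<subseteq> V" "card e = 2"
    using multipartiteD(1)[OF G] by (auto simp: simple_graph_def)
  obtain a b where "e = {a, b}" using e(4) by (meson card_2_iff)
  then obtain u where u: "e = {v, u}" using e(2) by auto
  moreover have "u \<notin> P i" using multipartiteD(4)[OF G assms(2,3)] e(1) u by blast
  ultimately show "e \<in> (\<lambda>u. {v, u}) ` (V - P i)" using e(3) by auto
next
  fix e assume "e \<in> (\<lambda>u. {v, u}) ` (V - P i)"
  then obtain u j where "e = {v, u}" "j < k" "u \<in> P j" "u \<notin> P i"
    using multipartiteD(2)[OF G] by blast
  then show "e \<in> {e \<in> E. v \<in> e}"
    using multipartiteD(5)[OF G assms(2) _ _ assms(3)] by blast
qed

lemma multipartite_degree:
  assumes G: "complete_multipartite V E k P" and "i < k" "v \<in> P i"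
  shows "card {e \<in> E. v \<in> e} = card V - card (P i)"
proof -
  have "P i \<subseteq> V" using multipartiteD(2)[OF G] assms(2) by blast
  then have "card (V - P i) = card V - card (P i)"
    using multipartite_finite[OF G] assms(2) by (simp add: card_Diff_subset)
  moreover have "inj_on (\<lambda>u. {v, u}) (V - P i)"
    using assms(3) by (auto simp: inj_on_def doubleton_eq_iff)
  ultimately show ?thesis
    using multipartite_edges_at[OF assms] by (simp add: card_image)
qed

lemma multipartite_sum:
  assumes "complete_multipartite V E k P"
  shows "(\<Sum>v\<in>V. f v) = (\<Sum>i<k. \<Sum>v\<in>P i. f v)"
  unfolding multipartiteD(2)[OF assms]
  by (rule sum.UNION_disjoint_family)
    (use multipartiteD(3)[OF assms] multipartite_finite(2)[OF assms] in auto)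

text \<open>The edge bound is applied with \<open>D = n * r + 1\<close>, which no degree exceeds:
  twice the number of edges is larger than \<open>D * n * (r + 1)\<close> by exactly
  \<open>n * (r - 1)\<close>. Doubling avoids fractions.\<close>

lemma deficiency_lower_bound:
  fixes n r :: nat
  assumes G: "complete_multipartite V E (r + 1) P" and n: "even (n * (r + 1))"
    and P: "\<And>i. i < r \<Longrightarrow> card (P i) = n" "card (P r) = n + 1"
  shows "int n * (int r - 1) \<le> 2 * deficiency V E"
proof -
  note simple = multipartiteD(1)[OF G]
  have cV: "card V = n * (r + 1) + 1"
    using multipartite_sum[OF G, of "\<lambda>_. 1::nat"] P by simp
  have deg: "card {e \<in> E. v \<in> e} = (if i = r then n * r else n * r + 1)" if "i < r + 1" "v \<in> P i" for i v
    using multipartite_degree[OF G that] P(1)[of i] P(2) cV that(1) by (cases "i = r") simp_all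
  have "card {e \<in> E. v \<in> e} \<le> n * r + 1" if v: "v \<in> V" for v
  proof -
    obtain i where "i < r + 1" "v \<in> P i" by (rule multipartite_vertexE[OF G v])
    then show ?thesis using deg[of i v] by (simp split: if_splits)
  qed
  from card_edges_le_deficiency[OF simple _ this]
  have 1: "int (card E) \<le> int ((n * r + 1) * (card V div 2)) + deficiency V E" by simp
  have "2 * card E = (\<Sum>i<r+1. \<Sum>v\<in>P i. if i = r then n * r else n * r + 1)"
    unfolding handshake[OF simple, symmetric] multipartite_sum[OF G]
    by (intro sum.cong refl) (simp add: deg)
  also have "\<dots> = r * (n * (n * r + 1)) + (n + 1) * (n * r)"
    using P by simp
  finally have 2: "2 * card E = r * (n * (n * r + 1)) + (n + 1) * (n * r)" .
  \<comment> \<open>\<open>card V\<close> is odd, so every matching misses a vertex and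
    \<open>h\<close> is exactly half of \<open>n * (r + 1)\<close>.\<close>
  define h where "h = card V div 2"
  have 3: "2 * h = n * (r + 1)"
    using n cV by (simp add: h_def)
  have "2 * int (card E) = int (r * (n * (n * r + 1)) + (n + 1) * (n * r))"
    using 2 by linarith
  moreover have "2 * (int (n * r + 1) * int h) = int (n * r + 1) * int (n * (r + 1))"
    using 3 by (metis mult.left_commute of_nat_mult of_nat_numeral)
  moreover have "int (card E) \<le> int (n * r + 1) * int h + deficiency V E"
    using 1 unfolding h_def by (simp only: of_nat_mult)
  ultimately have "int (r * (n * (n * r + 1)) + (n + 1) * (n * r))
      \<le> int (n * r + 1) * int (n * (r + 1)) + 2 * deficiency V E"
    by linarith
  then show ?thesis by (simp add: algebra_simps)
qed

section \<open>Edge colourings of bipartite graphs\<close>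

lemma ex_missing_color:
  fixes D :: nat
  assumes "finite A" "card A < D"
  obtains a where "a < D" "a \<notin> c ` A"
proof -
  have "card (c ` A) < card {..<D}"
    using card_image_le[OF assms(1), of c] assms(2) by simp
  then have "\<not> {..<D} \<subseteq> c ` A"
    using assms(1) by (meson card_mono finite_imageI not_less)
  then show ?thesis
    using that by auto
qed

text \<open>Koenig's theorem.\<close>
lemma bipartite_edge_coloring:
  fixes E :: "('a \<times> 'b) set"
  assumes "finite E" "\<And>x. card {y. (x, y) \<in> E} \<le> D" "\<And>y. card {x. (x, y) \<in> E} \<le> D"
  obtains c :: "'a \<Rightarrow> 'b \<Rightarrow> nat" where "\<And>x y. (x, y) \<in> E \<Longrightarrow> c x y < D"
    "\<And>x y y'. (x, y) \<in> E \<Longrightarrow> (x, y') \<in> E \<Longrightarrow> c x y = c x y' \<Longrightarrow> y = y'"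
    "\<And>x x' y. (x, y) \<in> E \<Longrightarrow> (x', y) \<in> E \<Longrightarrow> c x y = c x' y \<Longrightarrow> x = x'"
proof -
  have "\<exists>c :: 'a \<Rightarrow> 'b \<Rightarrow> nat. (\<forall>x y. (x, y) \<in> E \<longrightarrow> c x y < D) \<and>
    (\<forall>x y y'. (x, y) \<in> E \<and> (x, y') \<in> E \<and> c x y = c x y' \<longrightarrow> y = y') \<and>
    (\<forall>x x' y. (x, y) \<in> E \<and> (x', y) \<in> E \<and> c x y = c x' y \<longrightarrow> x = x')"
    using assms
  proof (induction E rule: finite_induct)
    case empty
    then show ?case by auto
  next
    case (insert e F)
    obtain u v where e: "e = (u, v)" by fastforce
    have fin: "finite {y. (x, y) \<in> insert e F}" "finite {x. (x, z) \<in> insert e F}" for x z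
      by (rule finite_subset[of _ "snd ` insert e F"], force, simp add: insert.hyps(1),
          rule finite_subset[of _ "fst ` insert e F"], force, simp add: insert.hyps(1))
    have finx: "finite {y. (x, y) \<in> F}" for x
      by (rule finite_subset[OF _ fin(1)[of x]]) auto
    have finy: "finite {x. (x, y) \<in> F}" for y
      by (rule finite_subset[OF _ fin(2)[of y]]) auto
    have degx: "card {y. (x, y) \<in> F} \<le> D" for x
      by (rule order_trans[OF card_mono[OF fin(1)] insert.prems(1)[of x]]) auto
    have degy: "card {x. (x, y) \<in> F} \<le> D" for y
      by (rule order_trans[OF card_mono[OF fin(2)] insert.prems(2)[of y]]) auto
    have "{y. (u, y) \<in> insert e F} = insert v {y. (u, y) \<in> F}" "{x. (x, v) \<in> insert e F} = insert u {x. (x, v) \<in> F}"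
      by (auto simp: e)
    then have degu: "card {y. (u, y) \<in> F} < D" and degv: "card {x. (x, v) \<in> F} < D"
      using insert.prems(1)[of u] insert.prems(2)[of v] insert.hyps(2) finx[of u] finy[of v] by (auto simp: e)
    obtain c :: "'a \<Rightarrow> 'b \<Rightarrow> nat" where cD: "\<And>x y. (x, y) \<in> F \<Longrightarrow> c x y < D"
      and cx: "\<And>x y y'. (x, y) \<in> F \<Longrightarrow> (x, y') \<in> F \<Longrightarrow> c x y = c x y' \<Longrightarrow> y = y'"
      and cy: "\<And>x x' y. (x, y) \<in> F \<Longrightarrow> (x', y) \<in> F \<Longrightarrow> c x y = c x' y \<Longrightarrow> x = x'"
      using insert.IH[OF degx degy] by blast
    obtain a where a: "a < D" "\<And>y. (u, y) \<in> F \<Longrightarrow> c u y \<noteq> a"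
      using ex_missing_color[OF finx degu, of "c u"] by (smt (verit) image_eqI mem_Collect_eq)
    obtain b where b: "b < D" "\<And>x. (x, v) \<in> F \<Longrightarrow> c x v \<noteq> b"
      using ex_missing_color[OF finy degv, of "\<lambda>x. c x v"] by (smt (verit) image_eqI mem_Collect_eq)
    \<comment> \<open>Exchange \<open>a\<close> and \<open>b\<close> on the component \<open>R\<close> of \<open>v\<close> (a Kempe chain). By parity it does not
      reach \<open>u\<close>, so \<open>a\<close> becomes free at both ends of the new edge.\<close>
    define r where "r = {(y, y'). \<exists>x. (x, y) \<in> F \<and> (x, y') \<in> F \<and> c x y = a \<and> c x y' = b}"
    define R where "R = {y. (v, y) \<in> r\<^sup>*}"
    have vR: "v \<in> R" by (simp add: R_def)
    have stepI: "y' \<in> R" if "y \<in> R" "(x, y) \<in> F" "(x, y') \<in> F" "c x y = a" "c x y' = b" for x y y'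
      using that by (auto simp: R_def r_def intro: rtrancl_into_rtrancl)
    \<comment> \<open>Colour \<open>b\<close> is missing at \<open>v\<close>, so \<open>y'\<close>
      has a predecessor in the chain. The \<open>b\<close>-coloured edge at \<open>y'\<close> is
      unique, so the predecessor is joined to this same \<open>x\<close> by colour
      \<open>a\<close>.\<close>
    have stepE: "\<exists>y \<in> R. (x, y) \<in> F \<and> c x y = a" if "y' \<in> R" "(x, y') \<in> F" "c x y' = b" for x y'
    proof -
      have "y' \<noteq> v" using that b by auto
      moreover have "(v, y') \<in> r\<^sup>*" using that by (simp add: R_def)
      ultimately obtain y where "(v, y) \<in> r\<^sup>*" "(y, y') \<in> r"
        by (metis rtranclE)
      then show ?thesis
        using that cy by (fastforce simp: R_def r_def)
    qed
    have eqv: "y \<in> R \<longleftrightarrow> y' \<in> R" if "(x, y) \<in> F" "(x, y') \<in> F" "c x y = a" "c x y' = b" for x y y'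
      using stepI[OF _ that] stepE[of y' x] that cx by metis
    \<comment> \<open>It suffices to track right-hand ends: by \<open>eqv\<close>, an
      \<open>a\<close>-coloured and a \<open>b\<close>-coloured edge at the same left-hand vertex
      are either both exchanged or both kept.\<close>
    define sw where "sw y k = (if y \<in> R then if k = a then b else if k = b then a else k else k)" for y k
    define c' where "c' x y = (if x = u \<and> y = v then a else sw y (c x y))" for x y
    have swD: "sw y k < D" if "k < D" for y k
      using that a(1) b(1) by (simp add: sw_def)
    have sw_inj: "k = l" if "sw y k = sw y l" for y k l
      using that by (simp add: sw_def split: if_splits)
    have swx: "y = y'" if "(x, y) \<in> F" "(x, y') \<in> F" "sw y (c x y) = sw y' (c x y')" for x y y'
    proof (cases "y \<in> R \<longleftrightarrow> y' \<in> R")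
      case True
      then have "sw y = sw y'" by (auto simp: sw_def)
      then show ?thesis using that cx sw_inj by metis
    next
      case False
      then have "c x y = c x y' \<or> c x y = a \<and> c x y' = b \<or> c x y = b \<and> c x y' = a"
        using that(3) by (auto simp: sw_def split: if_splits)
      then show ?thesis using False that(1,2) cx eqv by metis
    qed
    \<comment> \<open>A \<open>b\<close>-coloured edge from \<open>u\<close> into \<open>R\<close>
      would come after an \<open>a\<close>-coloured edge at \<open>u\<close>, where \<open>a\<close>
      is missing.\<close>
    have uR: "y \<notin> R" if "(u, y) \<in> F" "c u y = b" for y
      using stepE[of y u] that a by auto
    have swu: "sw y (c u y) \<noteq> a" if "(u, y) \<in> F" for y
      using a(2)[OF that] uR[OF that] by (auto simp: sw_def)
    have swv: "sw v (c x v) \<noteq> a" if "(x, v) \<in> F" for x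
      using b(2)[OF that] vR by (auto simp: sw_def)
    have nF: "(u, v) \<notin> F" using insert.hyps e by simp
    then have c'F: "c' x y = sw y (c x y)" if "(x, y) \<in> F" for x y
      using that by (auto simp: c'_def)
    have c'e: "c' u v = a" by (simp add: c'_def)
    show ?case
    proof (intro exI[of _ c'] conjI allI impI)
      show "c' x y < D" if "(x, y) \<in> insert e F" for x y
        using that a(1) cD swD c'F c'e by (auto simp: e)
      show "y = y'" if "(x, y) \<in> insert e F \<and> (x, y') \<in> insert e F \<and> c' x y = c' x y'" for x y y'
        using that swx swu c'F c'e unfolding e by (metis insert_iff prod.inject)
      show "x = x'" if "(x, y) \<in> insert e F \<and> (x', y) \<in> insert e F \<and> c' x y = c' x' y" for x x' y
        using that cy sw_inj swv c'F c'e unfolding e by (metis insert_iff prod.inject)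
    qed
  qed
  then show ?thesis
    using that by blast
qed

section \<open>Colourings of a labelled model\<close>

text \<open>Equal part sizes allow \<open>V\<close> to be relabelled by \<open>C\<close>, so that
  colours can be given by formulas in the labels. A common shift turns integer colours into positive
  ones. At \<open>x\<close> the deficiency is at most the length of the window from
  \<open>lo x\<close> to \<open>hi x\<close> minus the degree.\<close>

lemma deficiency_le_model:
  fixes C :: "'b set" and pt :: "'b \<Rightarrow> nat" and col :: "'b \<Rightarrow> 'b \<Rightarrow> int"
  assumes G: "complete_multipartite V E k P" and k: "k \<ge> 2"
    and C: "finite C" "\<And>x. x \<in> C \<Longrightarrow> pt x < k"
    and card_part: "\<And>i. i < k \<Longrightarrow> card {x \<in> C. pt x = i} = card (P i)"
    and sym: "\<And>x y. x \<in> C \<Longrightarrow> y \<in> C \<Longrightarrow> pt x \<noteq> pt y \<Longrightarrow> col x y = col y x"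
    and inj: "\<And>x. x \<in> C \<Longrightarrow> inj_on (col x) {y \<in> C. pt y \<noteq> pt x}"
    and range: "\<And>x y. x \<in> C \<Longrightarrow> y \<in> C \<Longrightarrow> pt x \<noteq> pt y \<Longrightarrow> lo x \<le> col x y \<and> col x y \<le> hi x"
  shows "deficiency V E \<le> (\<Sum>x\<in>C. hi x - lo x + 1 - int (card {y \<in> C. pt y \<noteq> pt x}))"
proof -
  note V = multipartiteD(2)[OF G]
  have simple: "simple_graph V E" by (rule multipartiteD(1)[OF G])
  have uniq: "i = j" if "i < k" "j < k" "v \<in> P i" "v \<in> P j" for i j v
    using disjoint_family_onD[OF multipartiteD(3)[OF G], of i j] that by auto
  have "\<exists>g. bij_betw g (P i) {x \<in> C. pt x = i}" if "i < k" for i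
    using that multipartite_finite(2)[OF G] C card_part by (intro finite_same_card_bij) auto
  then obtain g where g: "\<And>i. i < k \<Longrightarrow> bij_betw (g i) (P i) {x \<in> C. pt x = i}"
    by metis
  define f where "f v = g (THE i. i < k \<and> v \<in> P i) v" for v
  have f_eq: "f v = g i v" if "i < k" "v \<in> P i" for i v
  proof -
    have "(THE i. i < k \<and> v \<in> P i) = i" using that uniq by blast
    then show ?thesis by (simp add: f_def)
  qed
  have f_part: "bij_betw f (P i) {x \<in> C. pt x = i}" if "i < k" for i
    using g[OF that] f_eq[OF that] by (simp cong: bij_betw_cong)
  have "bij_betw f (\<Union>i\<in>{..<k}. P i) (\<Union>i\<in>{..<k}. {x \<in> C. pt x = i})"
    by (rule bij_betw_UNION_disjoint) (use f_part in \<open>auto simp: disjoint_family_on_def\<close>)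
  moreover have "(\<Union>i\<in>{..<k}. {x \<in> C. pt x = i}) = C"
    using C(2) by auto
  ultimately have f: "bij_betw f V C" using V by simp
  have fC: "f v \<in> C" if "v \<in> V" for v
    using bij_betwE[OF f] that by blast
  have f_inj: "u = v" if "u \<in> V" "v \<in> V" "f u = f v" for u v
    using f that by (auto simp: bij_betw_def inj_on_def)
  have pt_f: "pt (f v) = i" if "i < k" "v \<in> P i" for i v
    using bij_betwE[OF f_part[OF that(1)]] that(2) by blast
  have edge: "{u, v} \<in> E \<longleftrightarrow> pt (f u) \<noteq> pt (f v)" if uv: "u \<in> V" "v \<in> V" for u v
  proof -
    obtain i j where "i < k" "u \<in> P i" "j < k" "v \<in> P j"
      using multipartite_vertexE[OF G] uv by metis
    then show ?thesis using pt_f multipartiteD(4,5)[OF G] by metis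
  qed
  have edgeE: "\<exists>u \<in> V. e = {v, u} \<and> pt (f v) \<noteq> pt (f u) \<and> v \<in> V" if ev: "e \<in> E" "v \<in> e" for e v
  proof -
    have e: "e \<subseteq> V" "card e = 2" using simple ev(1) by (auto simp: simple_graph_def)
    then obtain u where "e = {v, u}" using ev(2) by (auto simp: card_2_iff)
    then show ?thesis using ev(1) e edge by auto
  qed
  \<comment> \<open>This shift exceeds \<open>- lo x\<close> for every \<open>x\<close> in
    \<open>C\<close>, so all shifted colours are positive.\<close>
  define K where "K = 1 + (\<Sum>x\<in>C. \<bar>lo x\<bar>)"
  have K: "K + lo x > 0" if "x \<in> C" for x
    using member_le_sum[OF that, of "\<lambda>x. \<bar>lo x\<bar>"] C(1) by (simp add: K_def)
  \<comment> \<open>An edge is an unordered pair; by the symmetry of \<open>col\<close>, the chosen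
    value does not depend on the order of its ends.\<close>
  define \<alpha> where "\<alpha> e = nat (K + (SOME c. \<exists>u v. e = {u, v} \<and> c = col (f u) (f v)))" for e
  have \<alpha>: "int (\<alpha> {u, v}) = K + col (f u) (f v)" "\<alpha> {u, v} > 0"
    if "u \<in> V" "v \<in> V" "pt (f u) \<noteq> pt (f v)" for u v
  proof -
    have "(SOME c. \<exists>u' v'. {u, v} = {u', v'} \<and> c = col (f u') (f v')) = col (f u) (f v)"
      using sym[of "f u" "f v"] that fC by (intro some_equality) (auto simp: doubleton_eq_iff)
    moreover have "K + col (f u) (f v) > 0"
      using range[of "f u" "f v"] K[of "f u"] fC that by fastforce
    ultimately show "int (\<alpha> {u, v}) = K + col (f u) (f v)" "\<alpha> {u, v} > 0"
      by (auto simp: \<alpha>_def)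
  qed
  have proper: "proper_edge_coloring E \<alpha>"
    unfolding proper_edge_coloring_def
  proof (intro conjI ballI impI)
    fix e assume e: "e \<in> E"
    then have "e \<noteq> {}" using simple by (auto simp: simple_graph_def)
    then obtain v where "v \<in> e" by auto
    then obtain u where "u \<in> V" "v \<in> V" "e = {v, u}" "pt (f v) \<noteq> pt (f u)"
      using edgeE[OF e] by metis
    then show "\<alpha> e > 0" using \<alpha>(2) by metis
  next
    fix e e' assume e: "e \<in> E" "e' \<in> E" "e \<noteq> e' \<and> e \<inter> e' \<noteq> {}"
    from e(3) obtain v where v: "v \<in> e" "v \<in> e'" by (meson disjoint_iff)
    obtain u u' where u: "u \<in> V" "e = {v, u}" "pt (f v) \<noteq> pt (f u)" "v \<in> V"
      "u' \<in> V" "e' = {v, u'}" "pt (f v) \<noteq> pt (f u')"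
      using edgeE[OF e(1) v(1)] edgeE[OF e(2) v(2)] by blast
    show "\<alpha> e \<noteq> \<alpha> e'"
    proof
      assume "\<alpha> e = \<alpha> e'"
      then have "col (f v) (f u) = col (f v) (f u')"
        using \<alpha>(1)[of v u] \<alpha>(1)[of v u'] u by simp
      then have "f u = f u'"
        using inj_onD[OF inj[of "f v"], of "f u" "f u'"] u fC by auto
      then show False using f_inj u e by blast
    qed
  qed
  have vd: "vertex_deficiency E \<alpha> v \<le> hi (f v) - lo (f v) + 1 - int (card {y \<in> C. pt y \<noteq> pt (f v)})"
    if v: "v \<in> V" for v
  proof -
    obtain i where i: "i < k" "v \<in> P i" by (rule multipartite_vertexE[OF G v])
    define S where "S = vertex_colors E \<alpha> v"
    have S: "finite S" using simple_graph_finite_edges[OF simple] by (simp add: S_def vertex_colors_def)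
    have Srange: "K + lo (f v) \<le> int c \<and> int c \<le> K + hi (f v)" if c: "c \<in> S" for c
    proof -
      obtain e where "e \<in> E" "v \<in> e" "c = \<alpha> e" using c by (auto simp: S_def vertex_colors_def)
      then obtain u where u: "u \<in> V" "pt (f v) \<noteq> pt (f u)" "c = \<alpha> {v, u}" using edgeE by blast
      then show ?thesis using \<alpha>(1)[of v u] range[of "f v" "f u"] v fC by simp
    qed
    have card: "card S = card {e \<in> E. v \<in> e}"
      unfolding S_def vertex_colors_def
      by (intro card_image) (use proper in \<open>auto simp: proper_edge_coloring_def inj_on_def\<close>)
    also have "\<dots> = card {y \<in> C. pt y \<noteq> pt (f v)}"
    proof -
      have "C - {x \<in> C. pt x = i} = {y \<in> C. pt y \<noteq> pt (f v)}" using pt_f[OF i] by auto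
      then have "card {y \<in> C. pt y \<noteq> pt (f v)} = card C - card {x \<in> C. pt x = i}"
        using C(1) by (metis (no_types, lifting) card_Diff_subset finite_subset mem_Collect_eq subsetI)
      then show ?thesis
        using multipartite_degree[OF G i] card_part[OF i(1)] bij_betw_same_card[OF f] by simp
    qed
    finally have card: "card S = card {y \<in> C. pt y \<noteq> pt (f v)}" .
    \<comment> \<open>As \<open>k \<ge> 2\<close>, \<open>v\<close> has a neighbour, so
      \<open>Min S\<close> and \<open>Max S\<close> are colours of edges and obey the range
      bounds.\<close>
    have "S \<noteq> {}"
    proof -
      obtain j where j: "j < k" "j \<noteq> i" using k by (metis One_nat_def Suc_1 Suc_le_lessD i(1) less_trans nat_neq_iff zero_less_one zero_neq_one lessI)
      have "P j \<noteq> {}" using G j(1) by (simp add: complete_multipartite_def)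
      then obtain u where "u \<in> P j" by auto
      then have "{v, u} \<in> E" using multipartiteD(5)[OF G] i j by metis
      then show ?thesis by (auto simp: S_def vertex_colors_def)
    qed
    then show ?thesis
      using Srange[of "Min S"] Srange[of "Max S"] S card
      by (simp add: vertex_deficiency_def Let_def flip: S_def)
  qed
  have "deficiency V E \<le> (\<Sum>v\<in>V. vertex_deficiency E \<alpha> v)"
    using deficiency_le[OF simple proper] by (simp add: coloring_deficiency_def)
  also have "\<dots> \<le> (\<Sum>v\<in>V. hi (f v) - lo (f v) + 1 - int (card {y \<in> C. pt y \<noteq> pt (f v)}))"
    by (intro sum_mono vd)
  also have "\<dots> = (\<Sum>x\<in>C. hi x - lo x + 1 - int (card {y \<in> C. pt y \<noteq> pt x}))"
    by (rule sum.reindex_bij_betw[OF f])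
  finally show ?thesis .
qed


text \<open>Degrees are \<open>n * r\<close> in the large part and \<open>n * r + 1\<close>
  elsewhere, so \<open>d x\<close> is the excess of the window at \<open>x\<close> over its degree,
  and the total excess bounds the deficiency.\<close>

lemma deficiency_le_near_balanced_model:
  fixes C :: "'b set" and pt :: "'b \<Rightarrow> nat" and col :: "'b \<Rightarrow> 'b \<Rightarrow> int" and d :: "'b \<Rightarrow> nat"
  assumes G: "complete_multipartite V E (r + 1) P" and r: "r \<ge> 1"
    and P: "\<And>i. i < r \<Longrightarrow> card (P i) = n" "card (P r) = n + 1"
    and C: "finite C" "\<And>x. x \<in> C \<Longrightarrow> pt x \<le> r"
    and card_part: "\<And>i. i \<le> r \<Longrightarrow> card {x \<in> C. pt x = i} = (if i = r then n + 1 else n)"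
    and sym: "\<And>x y. x \<in> C \<Longrightarrow> y \<in> C \<Longrightarrow> pt x \<noteq> pt y \<Longrightarrow> col x y = col y x"
    and inj: "\<And>x. x \<in> C \<Longrightarrow> inj_on (col x) {y \<in> C. pt y \<noteq> pt x}"
    and range: "\<And>x y. x \<in> C \<Longrightarrow> y \<in> C \<Longrightarrow> pt x \<noteq> pt y \<Longrightarrow> lo x \<le> col x y \<and>
      col x y < lo x + int (n * r) + (if pt x = r then 0 else 1) + int (d x)"
  shows "deficiency V E \<le> int (\<Sum>x\<in>C. d x)"
proof -
  have "C = (\<Union>i\<in>{..r}. {x \<in> C. pt x = i})"
    using C(2) by auto
  then have "card C = (\<Sum>i\<in>{..r}. card {x \<in> C. pt x = i})"
    using C(1) card_UN_disjoint[of "{..r}" "\<lambda>i. {x \<in> C. pt x = i}"] by fastforce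
  also have "\<dots> = (\<Sum>i\<in>{..r}. if i = r then n + 1 else n)"
    by (intro sum.cong refl) (simp add: card_part)
  also have "\<dots> = n * r + n + 1"
    by (simp flip: lessThan_Suc_atMost)
  finally have cC: "card C = n * r + n + 1" .
  have deg: "int (card {y \<in> C. pt y \<noteq> pt x}) = int (n * r) + (if pt x = r then 0 else 1)" if x: "x \<in> C" for x
  proof -
    have "{y \<in> C. pt y \<noteq> pt x} = C - {y \<in> C. pt y = pt x}" by auto
    then have "card {y \<in> C. pt y \<noteq> pt x} = card C - card {y \<in> C. pt y = pt x}"
      using C(1) by (simp add: card_Diff_subset)
    then show ?thesis using card_part[OF C(2)[OF x]] cC by simp
  qed
  define hi where "hi x = lo x + int (n * r) + (if pt x = r then 0 else 1) + int (d x) - 1" for x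
  have "deficiency V E \<le> (\<Sum>x\<in>C. hi x - lo x + 1 - int (card {y \<in> C. pt y \<noteq> pt x}))"
  proof (rule deficiency_le_model[where col = col, OF G _ C(1) _ _ sym inj])
    show "card {x \<in> C. pt x = i} = card (P i)" if "i < r + 1" for i
      using that card_part[of i] P(1)[of i] P(2) by (cases "i = r") simp_all
    show "lo x \<le> col x y \<and> col x y \<le> hi x" if "x \<in> C" "y \<in> C" "pt x \<noteq> pt y" for x y
      using range[OF that] by (simp add: hi_def)
  qed (use C(2) r in \<open>auto simp: less_Suc_eq_le\<close>)
  also have "\<dots> = (\<Sum>x\<in>C. int (d x))"
    by (intro sum.cong refl) (simp add: deg hi_def)
  finally show ?thesis by simp
qed

section \<open>Two labelled sides and an apex\<close>

datatype vertex = Left nat | Right nat | Apex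

text \<open>\<open>h\<close> is the size of a group of consecutive labels; the edges between the two sides that
  belong to one group are coloured like the edges inside a side, unless their label sum lies in \<open>X\<close>.\<close>

fun two_sided_color :: "nat \<Rightarrow> nat set \<Rightarrow> (nat \<Rightarrow> int) \<Rightarrow> (nat \<Rightarrow> nat \<Rightarrow> int) \<Rightarrow> (nat \<Rightarrow> int) \<Rightarrow>
    (nat \<Rightarrow> int) \<Rightarrow> vertex \<Rightarrow> vertex \<Rightarrow> int" where
  "two_sided_color h X s c a b (Left i) (Left j) = s (i + j)"
| "two_sided_color h X s c a b (Right i) (Right j) = s (i + j)"
| "two_sided_color h X s c a b (Left i) (Right j) =
    (if i div h = j div h \<and> i + j \<notin> X then s (i + j) else c i j)"
| "two_sided_color h X s c a b (Right j) (Left i) =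
    (if i div h = j div h \<and> i + j \<notin> X then s (i + j) else c i j)"
| "two_sided_color h X s c a b (Left i) Apex = a i"
| "two_sided_color h X s c a b Apex (Left i) = a i"
| "two_sided_color h X s c a b (Right j) Apex = b j"
| "two_sided_color h X s c a b Apex (Right j) = b j"
| "two_sided_color h X s c a b Apex Apex = 0"

lemma two_sided_color_commute:
  "two_sided_color h X s c a b x y = two_sided_color h X s c a b y x"
  by (cases x; cases y) (simp_all add: add.commute)

text \<open>Reduces properness and the count of gaps to conditions on four colour functions:
  \<open>s\<close> on label sums, \<open>c\<close> on the pairs in \<open>K\<close>,
  \<open>a\<close> and \<open>b\<close> on the apex edges. The length of
  \<open>{lo x..<up x}\<close> may exceed the degree of \<open>x\<close> by at most
  \<open>d x\<close>.\<close>

lemma deficiency_le_two_sided: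
  fixes pt :: "vertex \<Rightarrow> nat" and lo up :: "vertex \<Rightarrow> int" and p h :: nat and X :: "nat set"
  defines "C \<equiv> Left ` {..<p} \<union> Right ` {..<p} \<union> {Apex}"
  defines "K \<equiv> \<lambda>i j. i < p \<and> j < p \<and> pt (Left i) \<noteq> pt (Right j) \<and> (i div h \<noteq> j div h \<or> i + j \<in> X)"
  assumes G: "complete_multipartite V E (r + 1) P" and r: "r \<ge> 1"
    and P: "\<And>i. i < r \<Longrightarrow> card (P i) = n" "card (P r) = n + 1"
    and pt: "\<And>x. x \<in> C \<Longrightarrow> pt x \<le> r"
    and card_part: "\<And>i. i \<le> r \<Longrightarrow> card {x \<in> C. pt x = i} = (if i = r then n + 1 else n)"
    and group: "\<And>i j. i < p \<Longrightarrow> j < p \<Longrightarrow> i div h = j div h \<Longrightarrow> pt (Left i) = pt (Left j) \<and> pt (Right i) = pt (Right j)"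
    and X: "\<And>i j. i < p \<Longrightarrow> j < p \<Longrightarrow> i + j \<in> X \<Longrightarrow> i div h = j div h"
    and s: "\<And>t t'. t \<notin> X \<Longrightarrow> t' \<notin> X \<Longrightarrow> t + 1 < 2 * p \<Longrightarrow> t' + 1 < 2 * p \<Longrightarrow> s t = s t' \<Longrightarrow> t = t'"
    and c: "\<And>i j j'. K i j \<Longrightarrow> K i j' \<Longrightarrow> c i j = c i j' \<Longrightarrow> j = j'"
      "\<And>i i' j. K i j \<Longrightarrow> K i' j \<Longrightarrow> c i j = c i' j \<Longrightarrow> i = i'"
    and cs: "\<And>i j k. K i j \<Longrightarrow> k < p \<Longrightarrow> i + k \<notin> X \<Longrightarrow> c i j \<noteq> s (i + k)"
      "\<And>i j k. K i j \<Longrightarrow> k < p \<Longrightarrow> j + k \<notin> X \<Longrightarrow> c i j \<noteq> s (j + k)"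
    and as: "\<And>i k. i < p \<Longrightarrow> pt (Left i) \<noteq> pt Apex \<Longrightarrow> k < p \<Longrightarrow> i + k \<notin> X \<Longrightarrow> a i \<noteq> s (i + k)"
    and bs: "\<And>j k. j < p \<Longrightarrow> pt (Right j) \<noteq> pt Apex \<Longrightarrow> k < p \<Longrightarrow> j + k \<notin> X \<Longrightarrow> b j \<noteq> s (j + k)"
    and ac: "\<And>i j. K i j \<Longrightarrow> pt (Left i) \<noteq> pt Apex \<Longrightarrow> a i \<noteq> c i j"
    and bc: "\<And>i j. K i j \<Longrightarrow> pt (Right j) \<noteq> pt Apex \<Longrightarrow> b j \<noteq> c i j"
    and aa: "\<And>i i'. i < p \<Longrightarrow> i' < p \<Longrightarrow> pt (Left i) \<noteq> pt Apex \<Longrightarrow> pt (Left i') \<noteq> pt Apex \<Longrightarrow> a i = a i' \<Longrightarrow> i = i'"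
    and bb: "\<And>j j'. j < p \<Longrightarrow> j' < p \<Longrightarrow> pt (Right j) \<noteq> pt Apex \<Longrightarrow> pt (Right j') \<noteq> pt Apex \<Longrightarrow> b j = b j' \<Longrightarrow> j = j'"
    and ab: "\<And>i j. i < p \<Longrightarrow> j < p \<Longrightarrow> pt (Left i) \<noteq> pt Apex \<Longrightarrow> pt (Right j) \<noteq> pt Apex \<Longrightarrow> a i \<noteq> b j"
    and rs: "\<And>i k. i < p \<Longrightarrow> k < p \<Longrightarrow> i + k \<notin> X \<Longrightarrow> s (i + k) \<in> {lo (Left i)..<up (Left i)} \<inter> {lo (Right i)..<up (Right i)}"
    and rc: "\<And>i j. K i j \<Longrightarrow> c i j \<in> {lo (Left i)..<up (Left i)} \<inter> {lo (Right j)..<up (Right j)}"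
    and ra: "\<And>i. i < p \<Longrightarrow> pt (Left i) \<noteq> pt Apex \<Longrightarrow> a i \<in> {lo (Left i)..<up (Left i)} \<inter> {lo Apex..<up Apex}"
    and rb: "\<And>j. j < p \<Longrightarrow> pt (Right j) \<noteq> pt Apex \<Longrightarrow> b j \<in> {lo (Right j)..<up (Right j)} \<inter> {lo Apex..<up Apex}"
    and up: "\<And>x. x \<in> C \<Longrightarrow> up x \<le> lo x + int (n * r) + (if pt x = r then 0 else 1) + int (d x)"
  shows "deficiency V E \<le> int ((\<Sum>i<p. d (Left i)) + (\<Sum>j<p. d (Right j)) + d Apex)"
proof -
  let ?col = "two_sided_color h X s c a b"
  have CE: "(\<exists>i<p. x = Left i) \<or> (\<exists>j<p. x = Right j) \<or> x = Apex" if "x \<in> C" for x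
    using that by (auto simp: C_def)
  \<comment> \<open>A sum in \<open>X\<close> forces a common group, while vertices of one side in
    different parts lie in different groups; so \<open>X\<close> affects only edges between the
    sides.\<close>
  have color_LL: "i + j \<notin> X" if "i < p" "j < p" "pt (Left i) \<noteq> pt (Left j)" for i j
    using X group that by blast
  have color_RR: "i + j \<notin> X" if "i < p" "j < p" "pt (Right i) \<noteq> pt (Right j)" for i j
    using X group that by blast
  have range: "?col x y \<in> {lo x..<up x}" if xy: "x \<in> C" "y \<in> C" "pt x \<noteq> pt y" for x y
  proof -
    have LR: "?col (Left i) (Right j) \<in> {lo (Left i)..<up (Left i)} \<inter> {lo (Right j)..<up (Right j)}"
      if "i < p" "j < p" "pt (Left i) \<noteq> pt (Right j)" for i j
      using rs[of i j] rs[of j i] rc[of i j] that by (auto simp: K_def add.commute)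
    show ?thesis
      using CE[OF xy(1)] CE[OF xy(2)] xy(3) LR ra rb rs color_LL color_RR
      by (elim disjE exE conjE)
        (auto simp: two_sided_color_commute[of h X s c a b "Right _" "Left _"]
          two_sided_color_commute[of h X s c a b Apex] simp del: two_sided_color.simps(3,4,6,8))
  qed
  have inj: "inj_on (?col x) {y \<in> C. pt y \<noteq> pt x}" if x: "x \<in> C" for x
  proof (rule inj_onI, clarify)
    fix y z assume yz: "y \<in> C" "z \<in> C" "pt y \<noteq> pt x" "pt z \<noteq> pt x" and eq: "?col x y = ?col x z"
    have s': "j = k" if "i < p" "j < p" "k < p" "i + j \<notin> X" "i + k \<notin> X" "s (i + j) = s (i + k)" for i j k
      using s[of "i + j" "i + k"] that by simp
    from CE[OF x] show "y = z"
    proof (elim disjE exE conjE)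
      fix i assume i: "i < p" "x = Left i"
      \<comment> \<open>A sum colour leads to another group on the same side or to the same group on
        the other side. Hence each label \<open>j\<close> occurs at most once among these
        neighbours, and equal sums mean equal neighbours.\<close>
      have N: "(\<exists>j<p. y = Left j \<and> i + j \<notin> X \<and> i div h \<noteq> j div h \<and> ?col x y = s (i + j)) \<or>
          (\<exists>j<p. y = Right j \<and> i + j \<notin> X \<and> i div h = j div h \<and> ?col x y = s (i + j)) \<or>
          (\<exists>j. y = Right j \<and> K i j \<and> ?col x y = c i j) \<or>
          (y = Apex \<and> pt (Left i) \<noteq> pt Apex \<and> ?col x y = a i)"
        if y: "y \<in> C" "pt y \<noteq> pt x" for y
        using CE[OF y(1)]
      proof (elim disjE exE conjE)
        fix j assume j: "j < p" "y = Left j"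
        then have "pt (Left i) \<noteq> pt (Left j)" using y(2) i by simp
        then show ?thesis using j i(1) color_LL[of i j] group[of i j] unfolding i(2) by auto
      next
        fix j assume j: "j < p" "y = Right j"
        then have "pt (Left i) \<noteq> pt (Right j)" using y(2) i by simp
        then show ?thesis using j i(1) unfolding i(2) K_def by (cases "i div h = j div h \<and> i + j \<notin> X") (auto simp: add.commute)
      next
        assume "y = Apex"
        then show ?thesis using y(2) i by auto
      qed
      show ?thesis
        using N[OF yz(1,3)] N[OF yz(2,4)] eq i(1) s' c(1) cs(1) as ac
        by (elim disjE exE conjE) (simp_all; metis)+
    next
      fix i assume i: "i < p" "x = Right i"
      have N: "(\<exists>j<p. y = Right j \<and> i + j \<notin> X \<and> i div h \<noteq> j div h \<and> ?col x y = s (i + j)) \<or>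
          (\<exists>j<p. y = Left j \<and> i + j \<notin> X \<and> i div h = j div h \<and> ?col x y = s (i + j)) \<or>
          (\<exists>j. y = Left j \<and> K j i \<and> ?col x y = c j i) \<or>
          (y = Apex \<and> pt (Right i) \<noteq> pt Apex \<and> ?col x y = b i)"
        if y: "y \<in> C" "pt y \<noteq> pt x" for y
        using CE[OF y(1)]
      proof (elim disjE exE conjE)
        fix j assume j: "j < p" "y = Left j"
        then have "pt (Right i) \<noteq> pt (Left j)" using y(2) i by simp
        then show ?thesis using j i(1) unfolding i(2) K_def by (cases "i div h = j div h \<and> i + j \<notin> X") (auto simp: add.commute)
      next
        fix j assume j: "j < p" "y = Right j"
        then have "pt (Right i) \<noteq> pt (Right j)" using y(2) i by simp
        then show ?thesis using j i(1) color_RR[of i j] group[of i j] unfolding i(2) by auto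
      next
        assume "y = Apex"
        then show ?thesis using y(2) i by auto
      qed
      show ?thesis
        using N[OF yz(1,3)] N[OF yz(2,4)] eq i(1) s' c(2) cs(2) bs bc
        by (elim disjE exE conjE) (simp_all; metis)+
    next
      assume "x = Apex"
      then show ?thesis
        using CE[OF yz(1)] CE[OF yz(2)] yz(3,4) eq aa bb ab
        by (elim disjE exE conjE) (simp_all; metis)+
    qed
  qed
  have "deficiency V E \<le> int (\<Sum>x\<in>C. d x)"
  proof (rule deficiency_le_near_balanced_model[where col = ?col and lo = lo, OF G r P _ pt card_part _ inj])
    show "finite C" by (simp add: C_def)
    show "lo x \<le> ?col x y \<and> ?col x y < lo x + int (n * r) + (if pt x = r then 0 else 1) + int (d x)"
      if "x \<in> C" "y \<in> C" "pt x \<noteq> pt y" for x y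
      using range[OF that] up[OF that(1)] by auto
  qed (assumption | rule two_sided_color_commute)+
  also have "(\<Sum>x\<in>C. d x) = (\<Sum>i<p. d (Left i)) + (\<Sum>j<p. d (Right j)) + d Apex"
  proof -
    have "C = insert Apex (Left ` {..<p} \<union> Right ` {..<p})" by (auto simp: C_def)
    moreover have "Apex \<notin> Left ` {..<p} \<union> Right ` {..<p}" "Left ` {..<p} \<inter> Right ` {..<p} = {}" by auto
    ultimately show ?thesis
      by (simp add: sum.union_disjoint sum.reindex inj_on_def)
  qed
  finally show ?thesis .
qed

section \<open>The two constructions\<close>

lemma card_block:
  fixes h q k :: nat
  assumes "k < q"
  shows "card {j. j < q * h \<and> j div h = k} = h"
proof (cases "h = 0")
  case False
  have "{j. j < q * h \<and> j div h = k} = {k * h..<k * h + h}"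
  proof (intro equalityI subsetI)
    fix j assume "j \<in> {k * h..<k * h + h}"
    then have j: "k * h \<le> j" "j < Suc k * h" by auto
    then have "j div h = k" using False by (intro div_nat_eqI) (auto simp: mult.commute)
    moreover have "j < q * h" using j(2) mult_le_mono1[of "Suc k" q h] assms by simp
    ultimately show "j \<in> {j. j < q * h \<and> j div h = k}" by simp
  next
    fix j assume "j \<in> {j. j < q * h \<and> j div h = k}"
    then show "j \<in> {k * h..<k * h + h}"
      using False dividend_less_div_times[of h j] by (auto simp: mult.commute)
  qed
  then show ?thesis by simp
qed simp

lemma card_blocks:
  fixes h q :: nat
  assumes "A \<subseteq> {..<q}"
  shows "card {j. j < q * h \<and> j div h \<in> A} = card A * h"
proof -
  have fin: "finite A" using assms finite_subset by blast
  have "{j. j < q * h \<and> j div h \<in> A} = (\<Union>k\<in>A. {j. j < q * h \<and> j div h = k})" by auto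
  also have "card \<dots> = (\<Sum>k\<in>A. card {j. j < q * h \<and> j div h = k})"
    by (intro card_UN_disjoint) (use fin in auto)
  also have "\<dots> = (\<Sum>k\<in>A. h)"
    using assms by (intro sum.cong refl card_block) auto
  finally show ?thesis by simp
qed

lemma card_two_sided_part:
  "card {x \<in> Left ` {..<p} \<union> Right ` {..<p} \<union> {Apex}. pt x = i} =
    card {j. j < p \<and> pt (Left j) = i} + card {j. j < p \<and> pt (Right j) = i} + (if pt Apex = i then 1 else 0)"
proof -
  let ?L = "Left ` {j. j < p \<and> pt (Left j) = i}" and ?R = "Right ` {j. j < p \<and> pt (Right j) = i}"
    and ?A = "{x. x = Apex \<and> pt x = i}"
  have "{x \<in> Left ` {..<p} \<union> Right ` {..<p} \<union> {Apex}. pt x = i} = (?L \<union> ?R) \<union> ?A" by auto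
  also have "card \<dots> = card (?L \<union> ?R) + card ?A"
    by (intro card_Un_disjoint) auto
  also have "card (?L \<union> ?R) = card ?L + card ?R"
    by (intro card_Un_disjoint) auto
  also have "?A = (if pt Apex = i then {Apex} else {})" by auto
  finally show ?thesis by (simp add: card_image inj_on_def)
qed

text \<open>Apart from the apex, each of the \<open>2 * m\<close> parts is one group. A left vertex
  outside the first group has only \<open>D - 1\<close> middle edges, and its apex edge lies above
  the middle, so it has one gap. All other windows are as long as the degree, and there are
  \<open>p - n = n * (m - 1)\<close> gaps.\<close>

lemma deficiency_upper_bound_even_parts:
  assumes G: "complete_multipartite V E (r + 1) P" and n: "n \<ge> 1" and m: "r + 1 = 2 * m"
    and P: "\<And>i. i < r \<Longrightarrow> card (P i) = n" "card (P r) = n + 1"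
  shows "deficiency V E \<le> int (n * (m - 1))"
proof -
  define p where "p = m * n"
  \<comment> \<open>A vertex has \<open>p - n\<close> neighbours in the other groups across; the one
    further middle colour is meant for its apex edge or its antidiagonal edge.\<close>
  define D where "D = p - n + 1"
  have m1: "m \<ge> 1" using m by simp
  have np: "n \<le> p" using m1 by (simp add: p_def)
  have pD: "p = D + n - 1" "D \<ge> 1" using np n by (simp_all add: D_def)
  have nr: "n * r + 1 = p + D"
  proof -
    have "n * r + n = 2 * p" using arg_cong[OF m, of "\<lambda>x. n * x"] by (simp add: p_def algebra_simps)
    then show ?thesis using pD np by linarith
  qed
  have div0: "i div n = 0 \<longleftrightarrow> i < n" for i using n by (auto simp: div_eq_0_iff)
  have divm: "i div n < m" if "i < p" for i
    using that by (simp add: p_def less_mult_imp_div_less)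
  \<comment> \<open>The edges coloured from the middle. Row \<open>p\<close> is the apex. Including the antidiagonal
    \<open>i + j = n - 1\<close> of the first group makes its vertices see every middle colour; the sums below it
    then move up by one to close the gap.\<close>
  define F where "F = {(i, j). i < p \<and> j < p \<and> (i div n \<noteq> j div n \<or> i + j = n - 1)} \<union> {p} \<times> {n..<p}"
  have finF: "finite F"
    by (rule finite_subset[of _ "{..p} \<times> {..p}"]) (auto simp: F_def)
  have other: "card {j. j < p \<and> j div n \<noteq> k} \<le> p - n" if "k < m" for k
  proof -
    have "{j. j < p \<and> j div n \<noteq> k} = {j. j < m * n \<and> j div n \<in> {..<m} - {k}}"
      using divm by (auto simp: p_def)
    moreover have "card ({..<m} - {k}) = m - 1" using that by simp
    ultimately show ?thesis
      using card_blocks[of "{..<m} - {k}" m n] by (simp add: p_def diff_mult_distrib)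
  qed
  have insert_other: "card (insert x {j. j < p \<and> j div n \<noteq> k}) \<le> D" if "k < m" for k x
    using other[OF that] card_insert_le_m1[of D "{j. j < p \<and> j div n \<noteq> k}" x] by (simp add: D_def)
  have row: "card {j. (i, j) \<in> F} \<le> D" for i
  proof (cases "i < p")
    case True
    have "card {j. (i, j) \<in> F} \<le> card (insert (n - 1 - i) {j. j < p \<and> j div n \<noteq> i div n})"
      using True by (intro card_mono) (auto simp: F_def)
    then show ?thesis using insert_other[OF divm[OF True], of "n - 1 - i"] by linarith
  next
    case False
    then have "card {j. (i, j) \<in> F} \<le> card {n..<p}" by (intro card_mono) (auto simp: F_def)
    then show ?thesis by (simp add: D_def)
  qed
  have column: "card {i. (i, j) \<in> F} \<le> D" for j
  proof (cases "j < p")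
    case True
    have "card {i. (i, j) \<in> F} \<le> card (insert (if j < n then n - 1 - j else p) {i. i < p \<and> i div n \<noteq> j div n})"
      using True n by (intro card_mono) (auto simp: F_def)
    then show ?thesis using insert_other[OF divm[OF True]] by (meson le_trans)
  next
    case False
    then have "{i. (i, j) \<in> F} = {}" by (auto simp: F_def)
    then show ?thesis by simp
  qed
  obtain f :: "nat \<Rightarrow> nat \<Rightarrow> nat" where f: "\<And>i j. (i, j) \<in> F \<Longrightarrow> f i j < D"
    "\<And>i j j'. (i, j) \<in> F \<Longrightarrow> (i, j') \<in> F \<Longrightarrow> f i j = f i j' \<Longrightarrow> j = j'"
    "\<And>i i' j. (i, j) \<in> F \<Longrightarrow> (i', j) \<in> F \<Longrightarrow> f i j = f i' j \<Longrightarrow> i = i'"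
    using bipartite_edge_coloring[OF finF row column] by blast
  obtain z where z: "z < D" "z \<notin> f p ` {n..<p}"
    by (rule ex_missing_color[of "{n..<p}" D "f p"]) (simp_all add: D_def)
  \<comment> \<open>The colour missing at the apex has to be the least one of the middle.\<close>
  define g where "g i j = (if f i j = z then 0 else if f i j = 0 then z else f i j)" for i j
  have gD: "g i j < D" if "(i, j) \<in> F" for i j
    using f(1)[OF that] z(1) pD(2) by (simp add: g_def)
  have gf: "f i j = f i' j'" if "g i j = g i' j'" for i j i' j'
    using that by (simp add: g_def split: if_splits)
  have grow: "j = j'" if "(i, j) \<in> F" "(i, j') \<in> F" "g i j = g i j'" for i j j'
    using f(2) that gf by blast
  have gcol: "i = i'" if "(i, j) \<in> F" "(i', j) \<in> F" "g i j = g i' j" for i i' j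
    using f(3) that gf by blast
  have gp: "g p j > 0" if "n \<le> j" "j < p" for j
    using z that by (auto simp: g_def)
  \<comment> \<open>Left groups are the parts \<open>r, r - 1, ..., m\<close> and right groups the
    parts \<open>0, ..., m - 1\<close>, so the apex joins the first left group.\<close>
  define pt where "pt x = (case x of Left i \<Rightarrow> r - i div n | Right j \<Rightarrow> j div n | Apex \<Rightarrow> r)" for x
  \<comment> \<open>Without the antidiagonal sum \<open>n - 1\<close>, the values are
    \<open>1, ..., p - 1\<close> followed by numbers from \<open>p + D\<close> on; the middle
    \<open>p, ..., p + D - 1\<close> stays free.\<close>
  define s where "s t = int (if t + 1 < n then t + 1 else if t < p then t else t + D)" for t
  \<comment> \<open>For \<open>j < n\<close> the apex edge extends the window upwards by one; for
    larger \<open>j\<close> it takes the middle colour that the edges across leave over. The left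
    apex colours \<open>i + p + D\<close>, where \<open>i \<ge> n\<close>, continue the values of
    the first case.\<close>
  define b where "b j = int (if j < n then j + p + D else p + g p j)" for j
  define lo where "lo x = int (case x of Left i \<Rightarrow> if i < n then i + 1 else i
    | Right j \<Rightarrow> if j < n then j + 1 else j | Apex \<Rightarrow> p + 1)" for x
  define up where "up x = int (case x of Left i \<Rightarrow> if i < n then i + p + D else i + p + D + 1
    | Right j \<Rightarrow> if j < n then j + p + D + 1 else j + p + D | Apex \<Rightarrow> 2 * p + D)" for x
  define d where "d x = (case x of Left i \<Rightarrow> if i < n then 0 else 1 | _ \<Rightarrow> (0::nat))" for x
  have ptL: "pt (Left i) \<noteq> pt Apex \<Longrightarrow> i \<ge> n" for i
    using div0[of i] by (fastforce simp: pt_def)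
  have K: "(i, j) \<in> F" if "i < p \<and> j < p \<and> pt (Left i) \<noteq> pt (Right j) \<and> (i div n \<noteq> j div n \<or> i + j \<in> {n - 1})" for i j
    using that by (auto simp: F_def)
  have pF: "(p, j) \<in> F" if "n \<le> j" "j < p" for j
    using that by (simp add: F_def)
  have s_out: "s t < int p \<or> s t \<ge> int (p + D)" for t
    using np by (auto simp: s_def)
  have "deficiency V E \<le> int ((\<Sum>i<p. d (Left i)) + (\<Sum>j<p. d (Right j)) + d Apex)"
  proof (rule deficiency_le_two_sided[where h = n and X = "{n - 1}" and s = s and pt = pt and lo = lo
        and up = up and d = d and p = p and c = "\<lambda>i j. int (p + g i j)" and a = "\<lambda>i. int (i + p + D)" and b = b,
        OF G _ P])
    show "r \<ge> 1" using m m1 by linarith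
    show "pt x \<le> r" if "x \<in> Left ` {..<p} \<union> Right ` {..<p} \<union> {Apex}" for x
      using that divm m by (fastforce simp: pt_def)
    show "card {x \<in> Left ` {..<p} \<union> Right ` {..<p} \<union> {Apex}. pt x = i} = (if i = r then n + 1 else n)" if "i \<le> r" for i
    proof -
      have L: "{j. j < p \<and> pt (Left j) = i} = (if m \<le> i then {j. j < m * n \<and> j div n = r - i} else {})"
      proof -
        have "r - j div n = i \<longleftrightarrow> m \<le> i \<and> j div n = r - i" if "j < p" for j
          using divm[OF that] m \<open>i \<le> r\<close> by linarith
        then show ?thesis by (auto simp: pt_def p_def)
      qed
      have R: "{j. j < p \<and> pt (Right j) = i} = (if i < m then {j. j < m * n \<and> j div n = i} else {})"
        using divm by (auto simp: pt_def p_def)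
      have A: "pt Apex = r" by (simp add: pt_def)
      show ?thesis
        using card_block[of i m n] card_block[of "r - i" m n] m m1 that
        unfolding card_two_sided_part L R A by auto
    qed
    show "pt (Left i) = pt (Left j) \<and> pt (Right i) = pt (Right j)" if "i div n = j div n" for i j
      using that by (simp add: pt_def)
    show "i div n = j div n" if "i + j \<in> {n - 1}" for i j
      using that n div0[of i] div0[of j] by auto
    show "t = t'" if "t \<notin> {n - 1}" "t' \<notin> {n - 1}" "s t = s t'" for t t'
      using that np by (auto simp: s_def split: if_splits)
    show "j = j'" if "i < p \<and> j < p \<and> pt (Left i) \<noteq> pt (Right j) \<and> (i div n \<noteq> j div n \<or> i + j \<in> {n - 1})"
      "i < p \<and> j' < p \<and> pt (Left i) \<noteq> pt (Right j') \<and> (i div n \<noteq> j' div n \<or> i + j' \<in> {n - 1})"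
      "int (p + g i j) = int (p + g i j')" for i j j'
      using grow[OF K[OF that(1)] K[OF that(2)]] that(3) by simp
    show "i = i'" if "i < p \<and> j < p \<and> pt (Left i) \<noteq> pt (Right j) \<and> (i div n \<noteq> j div n \<or> i + j \<in> {n - 1})"
      "i' < p \<and> j < p \<and> pt (Left i') \<noteq> pt (Right j) \<and> (i' div n \<noteq> j div n \<or> i' + j \<in> {n - 1})"
      "int (p + g i j) = int (p + g i' j)" for i i' j
      using gcol[OF K[OF that(1)] K[OF that(2)]] that(3) by simp
    show "int (p + g i j) \<noteq> s (i + k)" if "i < p \<and> j < p \<and> pt (Left i) \<noteq> pt (Right j) \<and> (i div n \<noteq> j div n \<or> i + j \<in> {n - 1})" for i j k
      using gD[OF K[OF that]] s_out[of "i + k"] by auto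
    show "int (p + g i j) \<noteq> s (j + k)" if "i < p \<and> j < p \<and> pt (Left i) \<noteq> pt (Right j) \<and> (i div n \<noteq> j div n \<or> i + j \<in> {n - 1})" for i j k
      using gD[OF K[OF that]] s_out[of "j + k"] by auto
    show "int (i + p + D) \<noteq> s (i + k)" if "k < p" for i k
      using that np by (auto simp: s_def)
    show "b j \<noteq> s (j + k)" if "j < p" "k < p" for j k
    proof (cases "j < n")
      case True
      then show ?thesis using that np by (auto simp: s_def b_def)
    next
      case False
      then show ?thesis using gD[OF pF[of j]] s_out[of "j + k"] that by (auto simp: b_def)
    qed
    show "int (i + p + D) \<noteq> int (p + g i j)" if "i < p \<and> j < p \<and> pt (Left i) \<noteq> pt (Right j) \<and> (i div n \<noteq> j div n \<or> i + j \<in> {n - 1})" for i j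
      using gD[OF K[OF that]] by simp
    show "b j \<noteq> int (p + g i j)" if "i < p \<and> j < p \<and> pt (Left i) \<noteq> pt (Right j) \<and> (i div n \<noteq> j div n \<or> i + j \<in> {n - 1})" for i j
      using gD[OF K[OF that]] gcol[OF K[OF that] pF[of j]] that by (auto simp: b_def)
    show "i = i'" if "int (i + p + D) = int (i' + p + D)" for i i'
      using that by simp
    show "j = j'" if "j < p" "j' < p" "b j = b j'" for j j'
      using that gD[OF pF[of j]] gD[OF pF[of j']] grow[OF pF[of j] pF[of j']]
      by (auto simp: b_def split: if_splits)
    show "int (i + p + D) \<noteq> b j" if "pt (Left i) \<noteq> pt Apex" "j < p" for i j
      using ptL[OF that(1)] gD[OF pF[of j]] that(2) by (auto simp: b_def)
    show "s (i + k) \<in> {lo (Left i)..<up (Left i)} \<inter> {lo (Right i)..<up (Right i)}" if "i < p" "k < p" "i + k \<notin> {n - 1}" for i k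
      using that np pD by (auto simp: s_def lo_def up_def)
    show "int (p + g i j) \<in> {lo (Left i)..<up (Left i)} \<inter> {lo (Right j)..<up (Right j)}"
      if "i < p \<and> j < p \<and> pt (Left i) \<noteq> pt (Right j) \<and> (i div n \<noteq> j div n \<or> i + j \<in> {n - 1})" for i j
      using gD[OF K[OF that]] that np by (auto simp: lo_def up_def)
    show "int (i + p + D) \<in> {lo (Left i)..<up (Left i)} \<inter> {lo Apex..<up Apex}" if "i < p" "pt (Left i) \<noteq> pt Apex" for i
      using ptL[OF that(2)] that(1) pD n by (auto simp: lo_def up_def)
    show "b j \<in> {lo (Right j)..<up (Right j)} \<inter> {lo Apex..<up Apex}" if "j < p" for j
      using gD[OF pF[of j]] gp[of j] that np pD n by (auto simp: lo_def up_def b_def)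
    show "up x \<le> lo x + int (n * r) + (if pt x = r then 0 else 1) + int (d x)"
      if "x \<in> Left ` {..<p} \<union> Right ` {..<p} \<union> {Apex}" for x
    proof -
      have nr': "int (n * r) = int p + int D - 1" using nr by linarith
      show ?thesis
      proof (cases x)
        case (Left i)
        have "i < n" if "pt (Left i) = r"
        proof -
          have "r - i div n = r" using that by (simp only: pt_def vertex.case)
          then have "i div n = 0" using m m1 by linarith
          then show ?thesis using div0 by simp
        qed
        then show ?thesis unfolding nr' Left by (auto simp: up_def lo_def d_def)
      next
        case (Right j)
        then have "pt (Right j) \<noteq> r" using that divm[of j] m by (auto simp: pt_def)
        then show ?thesis unfolding nr' Right by (auto simp: up_def lo_def d_def)
      next
        case Apex
        then show ?thesis unfolding nr' by (auto simp: up_def lo_def d_def pt_def)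
      qed
    qed
  qed
  also have "(\<Sum>i<p. d (Left i)) = (\<Sum>i\<in>{n..<p}. 1)"
    by (rule sum.mono_neutral_cong_right) (auto simp: d_def)
  finally have "deficiency V E \<le> int (p - n)"
    by (simp add: d_def)
  also have "p - n = n * (m - 1)"
    by (simp add: p_def diff_mult_distrib2 mult.commute)
  finally show ?thesis .
qed

text \<open>Groups are half parts, and the two groups of a part have different positions, so groups
  of the same position remain adjacent across. Gaps occur at the left labels
  \<open>h, ..., p - h - 1\<close>, which are \<open>h * (r - 1)\<close> many, and at the right
  label \<open>p - h\<close>.\<close>

lemma deficiency_upper_bound_even_size:
  assumes G: "complete_multipartite V E (r + 1) P" and h: "h \<ge> 1" and r: "r \<ge> 2"
    and P: "\<And>i. i < r \<Longrightarrow> card (P i) = 2 * h" "card (P r) = 2 * h + 1"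
  shows "deficiency V E \<le> int (h * (r - 1) + 1)"
proof -
  define p where "p = (r + 1) * h"
  \<comment> \<open>Across, a vertex meets \<open>r - 1\<close> groups of other parts and other
    positions, which gives \<open>p - 2 * h\<close> edges; again one middle colour is added for an
    apex or antidiagonal edge.\<close>
  define D where "D = p - 2 * h + 1"
  have rh: "p - h = r * h" by (simp add: p_def)
  have hp: "3 * h \<le> p" using r mult_le_mono1[of 3 "r + 1" h] by (simp add: p_def)
  have pD: "p + 1 = D + 2 * h" using hp by (simp add: D_def)
  have nr: "2 * h * r + 1 = p + D"
    using r by (cases r) (simp_all add: D_def p_def algebra_simps)
  have divr: "i div h \<le> r" if "i < p" for i
    using that less_mult_imp_div_less[of i "r + 1" h] by (simp add: p_def)
  have div0: "i div h = 0 \<longleftrightarrow> i < h" for i using h by (auto simp: div_eq_0_iff)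
  have div_last: "i div h = r \<longleftrightarrow> p - h \<le> i" if "i < p" for i
  proof -
    have "r \<le> i div h \<longleftrightarrow> p - h \<le> i"
      using h by (simp add: rh less_eq_div_iff_mult_less_eq)
    then show ?thesis using divr[OF that] by linarith
  qed
  \<comment> \<open>The perfect matching \<open>i \<mapsto> \<mu> i\<close> gets the least middle colour \<open>p\<close>, so the apex misses \<open>p\<close>.\<close>
  define nxt where "nxt k = (if k = r then 0 else Suc k)" for k
  define \<mu> where "\<mu> i = nxt (i div h) * h + (h - 1 - i mod h)" for i
  have \<mu>_div: "\<mu> i div h = nxt (i div h)" and \<mu>_mod: "\<mu> i mod h = h - 1 - i mod h" for i
    using h by (simp_all add: \<mu>_def)
  have nxt_le: "nxt k \<le> r" if "k \<le> r" for k using that by (simp add: nxt_def)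
  have \<mu>_less: "\<mu> i < p" if "i < p" for i
  proof -
    have "\<mu> i < nxt (i div h) * h + h" using h by (simp add: \<mu>_def)
    also have "\<dots> \<le> p"
      using mult_le_mono1[of "Suc (nxt (i div h))" "r + 1" h] nxt_le[OF divr[OF that]] by (simp add: p_def)
    finally show ?thesis .
  qed
  have \<mu>_inj: "i = i'" if "\<mu> i = \<mu> i'" "i < p" "i' < p" for i i'
  proof -
    have "nxt (i div h) = nxt (i' div h)" using \<mu>_div that(1) by metis
    then have 1: "i div h = i' div h" by (auto simp: nxt_def split: if_splits)
    have "h - 1 - i mod h = h - 1 - i' mod h" using \<mu>_mod that(1) by metis
    moreover have "i mod h < h" "i' mod h < h" using h by simp_all
    ultimately have "i mod h = i' mod h" by linarith
    with 1 show ?thesis by (metis div_mult_mod_eq)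
  qed
  have \<mu>_surj: "\<exists>i<p. \<mu> i = j" if "j < p" for j
  proof -
    have "\<mu> ` {..<p} = {..<p}"
      by (rule endo_inj_surj) (use \<mu>_less \<mu>_inj in \<open>auto simp: inj_on_def\<close>)
    then show ?thesis using that by (metis imageE lessThan_iff)
  qed
  \<comment> \<open>The reversal of positions inside \<open>\<mu>\<close> serves this value: the
    last label of group \<open>r - 1\<close> is matched to the first label of group
    \<open>r\<close>.\<close>
  have \<mu>_top: "\<mu> (p - h - 1) = p - h"
  proof -
    have eq: "p - h - 1 = (h - 1) + (r - 1) * h"
      using h r by (cases r) (simp_all add: rh)
    have "(x + (r - 1) * h) div h = r - 1" "(x + (r - 1) * h) mod h = x" if "x < h" for x
      using that by simp_all
    from this[of "h - 1"] have "(p - h - 1) div h = r - 1" "(p - h - 1) mod h = h - 1"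
      unfolding eq using h by simp_all
    moreover have "nxt (r - 1) = r" using r unfolding nxt_def by (cases r) auto
    ultimately have "\<mu> (p - h - 1) = r * h + (h - 1 - (h - 1))" unfolding \<mu>_def by (simp only:)
    then show ?thesis by (simp add: rh)
  qed
  \<comment> \<open>The antidiagonals of the first and of the last group, which are coloured from the middle.\<close>
  define X where "X = {h - 1, 2 * p - h - 1}"
  have X: "i < h \<and> j < h \<or> p - h \<le> i \<and> p - h \<le> j" if "i + j \<in> X" "i < p" "j < p" for i j
    using that h hp by (auto simp: X_def)
  \<comment> \<open>Part \<open>i < r\<close> consists of left group \<open>r - i\<close> and right
    group \<open>r - 1 - i\<close>; part \<open>r\<close> has left group \<open>0\<close>, right
    group \<open>r\<close> and the apex. Thus right group \<open>k\<close> shares its part with left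
    group \<open>nxt k\<close>.\<close>
  define pt where "pt x = (case x of Left i \<Rightarrow> r - i div h
    | Right j \<Rightarrow> if j div h = r then r else r - 1 - j div h | Apex \<Rightarrow> r)" for x
  have adj: "pt (Left i) \<noteq> pt (Right j) \<longleftrightarrow> nxt (j div h) \<noteq> i div h" if "i < p" "j < p" for i j
    using divr[OF that(1)] divr[OF that(2)] r by (auto simp: pt_def nxt_def)
  have ptA: "pt Apex = r" by (simp add: pt_def)
  have ptL: "pt (Left i) = r \<longleftrightarrow> i < h" if "i < p" for i
    using divr[OF that] div0[of i] r by (auto simp: pt_def)
  have ptR: "pt (Right j) = r \<longleftrightarrow> p - h \<le> j" if "j < p" for j
    using divr[OF that] div_last[OF that] r by (auto simp: pt_def)

  \<comment> \<open>The middle edges and their colouring by Koenig's theorem\<close>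
  define K where "K i j \<longleftrightarrow> i < p \<and> j < p \<and> pt (Left i) \<noteq> pt (Right j) \<and> (i div h \<noteq> j div h \<or> i + j \<in> X)" for i j
  define F where "F = {(i, j). K i j \<and> j \<noteq> \<mu> i} \<union> {p} \<times> {h..<p - h}"
  have finF: "finite F"
    by (rule finite_subset[of _ "{..p} \<times> {..p}"]) (auto simp: F_def K_def)
  have others: "card {j. j < p \<and> j div h \<noteq> k \<and> j div h \<noteq> l} = D - 1" if "k \<le> r" "l \<le> r" "k \<noteq> l" for k l
  proof -
    have "{j. j < p \<and> j div h \<noteq> k \<and> j div h \<noteq> l} = {j. j < (r + 1) * h \<and> j div h \<in> {..r} - {k, l}}"
      using divr by (auto simp: p_def)
    moreover have sub: "{..r} - {k, l} \<subseteq> {..<r + 1}" by auto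
    moreover have "card ({..r} - {k, l}) = r - 1" using that by (simp add: card_Diff_subset)
    ultimately have "card {j. j < p \<and> j div h \<noteq> k \<and> j div h \<noteq> l} = (r - 1) * h"
      using card_blocks[of "{..r} - {k, l}" "r + 1" h, OF sub] by (simp only:)
    then show ?thesis using nr pD hp r by (simp add: D_def p_def algebra_simps)
  qed
  \<comment> \<open>Removing the matching partner \<open>y\<close> makes room for one antidiagonal
    or apex edge, so that \<open>D - 1\<close> colours suffice beside the colour of the
    matching.\<close>
  have insert_others: "card (insert x ({j. j < p \<and> j div h \<noteq> k \<and> j div h \<noteq> l} - {y})) \<le> D - 1"
    if "k \<le> r" "l \<le> r" "k \<noteq> l" "y < p" "y div h \<noteq> k" "y div h \<noteq> l" for x y k l
  proof -
    let ?S = "{j. j < p \<and> j div h \<noteq> k \<and> j div h \<noteq> l}"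
    have y: "y \<in> ?S" using that by simp
    have "finite ?S" by simp
    then have "card (?S - {y}) < card ?S" by (rule card_Diff1_less[OF _ y])
    then show ?thesis
      using card_insert_le_m1[of "D - 1" "?S - {y}" x] unfolding others[OF that(1-3)] by linarith
  qed
  have row: "card {j. (i, j) \<in> F} \<le> D - 1" for i
  proof (cases "i < p")
    case True
    \<comment> \<open>The right group that lies in the same part as \<open>Left i\<close>.\<close>
    define l where "l = (if i div h = 0 then r else i div h - 1)"
    have l: "l \<le> r" "l \<noteq> i div h" "nxt l = i div h" using divr[OF True] r by (auto simp: l_def nxt_def)
    have "card {j. (i, j) \<in> F} \<le>
      card (insert (if i < h then h - 1 - i else 2 * p - h - 1 - i) ({j. j < p \<and> j div h \<noteq> i div h \<and> j div h \<noteq> l} - {\<mu> i}))"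
    proof (intro card_mono subsetI)
      fix j assume "j \<in> {j. (i, j) \<in> F}"
      then have j: "K i j" "j \<noteq> \<mu> i" using True by (auto simp: F_def)
      then have "j div h \<noteq> l" using adj[of i j] l(3) by (auto simp: K_def)
      moreover have "j = (if i < h then h - 1 - i else 2 * p - h - 1 - i)" if "i + j \<in> X"
        using that X[OF that] j True hp by (auto simp: K_def X_def)
      ultimately show "j \<in> insert (if i < h then h - 1 - i else 2 * p - h - 1 - i) ({j. j < p \<and> j div h \<noteq> i div h \<and> j div h \<noteq> l} - {\<mu> i})"
        using j by (auto simp: K_def)
    qed simp
    also have "\<dots> \<le> D - 1"
      by (rule insert_others[OF divr[OF True] l(1) l(2)[symmetric] \<mu>_less[OF True]])
        (use divr[OF True] r in \<open>auto simp: \<mu>_div nxt_def l_def\<close>)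
    finally show ?thesis .
  next
    case False
    then have "card {j. (i, j) \<in> F} \<le> card {h..<p - h}" by (intro card_mono) (auto simp: F_def K_def)
    then show ?thesis by (simp add: D_def)
  qed
  have column: "card {i. (i, j) \<in> F} \<le> D - 1" for j
  proof (cases "j < p")
    case True
    obtain y where y: "y < p" "\<mu> y = j" using \<mu>_surj[OF True] by auto
    let ?x = "if j < h then h - 1 - j else if p - h \<le> j then 2 * p - h - 1 - j else p"
    have "card {i. (i, j) \<in> F} \<le>
      card (insert ?x ({i. i < p \<and> i div h \<noteq> j div h \<and> i div h \<noteq> nxt (j div h)} - {y}))"
    proof (intro card_mono subsetI)
      fix i assume "i \<in> {i. (i, j) \<in> F}"
      then consider "K i j" "i \<noteq> y" | "i = p" "h \<le> j" "j < p - h" using y by (auto simp: F_def)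
      then show "i \<in> insert ?x ({i. i < p \<and> i div h \<noteq> j div h \<and> i div h \<noteq> nxt (j div h)} - {y})"
      proof cases
        case 1
        then have "i div h \<noteq> nxt (j div h)" using adj[of i j] by (auto simp: K_def)
        moreover have "i = ?x" if "i + j \<in> X"
          using that X[OF that] 1 True hp h by (auto simp: K_def X_def)
        ultimately show ?thesis using 1 by (auto simp: K_def)
      qed simp
    qed simp
    also have "\<dots> \<le> D - 1"
    proof (rule insert_others[OF divr[OF True] nxt_le[OF divr[OF True]] _ y(1)])
      have "j div h = nxt (y div h)" using y \<mu>_div by auto
      then show "j div h \<noteq> nxt (j div h)" "y div h \<noteq> j div h" "y div h \<noteq> nxt (j div h)"
        using r by (auto simp: nxt_def split: if_splits)
    qed
    finally show ?thesis .
  next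
    case False
    then have "{i. (i, j) \<in> F} = {}" by (auto simp: F_def K_def)
    then show ?thesis by simp
  qed
  obtain f :: "nat \<Rightarrow> nat \<Rightarrow> nat" where f: "\<And>i j. (i, j) \<in> F \<Longrightarrow> f i j < D - 1"
    "\<And>i j j'. (i, j) \<in> F \<Longrightarrow> (i, j') \<in> F \<Longrightarrow> f i j = f i j' \<Longrightarrow> j = j'"
    "\<And>i i' j. (i, j) \<in> F \<Longrightarrow> (i', j) \<in> F \<Longrightarrow> f i j = f i' j \<Longrightarrow> i = i'"
    using bipartite_edge_coloring[OF finF row column] by blast
  have KF: "(i, j) \<in> F" if "K i j" "j \<noteq> \<mu> i" for i j
    using that by (simp add: F_def)
  have pF: "(p, j) \<in> F" if "h \<le> j" "j < p - h" for j
    using that by (simp add: F_def)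
  \<comment> \<open>The apex edges at the left vertices \<open>u\<close> and \<open>u + 1\<close> would both need colour \<open>2 p - h - 1 + D\<close>.
    So the one at \<open>u\<close> gets \<open>p\<close>, and the matching edge from \<open>u\<close> to \<open>p - h\<close>, at both of whose ends the
    colour \<open>2 p - h - 1 + D\<close> comes next, gives up \<open>p\<close> for it.\<close>
  define u where "u = p - h - 1"
  have u: "h \<le> u" "u + h + 1 = p" using hp h by (simp_all add: u_def)
  have \<mu>_u: "\<mu> u = p - h" using \<mu>_top by (simp add: u_def)
  have \<mu>_ph: "i = u" if "\<mu> i = p - h" "i < p" for i
    using \<mu>_inj[of i u] that \<mu>_u u by simp
  \<comment> \<open>The second sum in \<open>X\<close>, \<open>2 * p - h - 1\<close>, would leave a
    second hole; lowering all later values by one closes it.\<close>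
  define s where "s t = int (if t + 1 < h then t + 1 else if t < p then t else if t < 2 * p - h then t + D else t + D - 1)" for t
  define c where "c i j = int (if i = u \<and> j = p - h then 2 * p - h - 1 + D else if j = \<mu> i then p else p + 1 + f i j)" for i j
  define a where "a i = int (if i = u then p else if i < p - h then i + p + D else i + p + D - 1)" for i
  define b where "b j = int (if j < h then j + p + D else p + 1 + f p j)" for j
  define lo where "lo x = int (case x of Left i \<Rightarrow> if i < h then i + 1 else i
    | Right j \<Rightarrow> if j < h then j + 1 else j | Apex \<Rightarrow> p)" for x
  define up where "up x = int (case x of
      Left i \<Rightarrow> if h \<le> i \<and> i < p - h then i + p + D + 1 else i + p + D
    | Right j \<Rightarrow> if j < h then j + p + D + 1 else if j \<le> p - h then j + p + D else j + p + D - 1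
    | Apex \<Rightarrow> 2 * p + D - 1)" for x
  \<comment> \<open>The left vertices counted here miss one middle colour.
    \<open>Right (p - h)\<close> has an edge for every middle colour, but its matching edge has
    given up \<open>p\<close>.\<close>
  define d where "d x = (case x of Left i \<Rightarrow> if h \<le> i \<and> i < p - h then 1 else 0
    | Right j \<Rightarrow> if j = p - h then 1 else 0 | Apex \<Rightarrow> (0::nat))" for x
  have c_cases: "i = u \<and> j = p - h \<and> c i j = int (2 * p - h - 1 + D) \<or>
      \<not> (i = u \<and> j = p - h) \<and> j = \<mu> i \<and> c i j = int p \<or>
      \<not> (i = u \<and> j = p - h) \<and> j \<noteq> \<mu> i \<and> (i, j) \<in> F \<and> c i j = int (p + 1 + f i j) \<and> f i j < D - 1" if "K i j" for i j
    using KF[OF that] f(1)[of i j] \<mu>_u by (auto simp: c_def)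
  \<comment> \<open>The three kinds of values of \<open>c\<close> have separate ranges: the
    exceptional colour is at least \<open>p + D\<close>, the matching has \<open>p\<close>, and
    Koenig's colours lie strictly between. So equal colours are of the same kind.\<close>
  have c_eqD: "i = u \<and> j = p - h \<and> i' = u \<and> j' = p - h \<or> j = \<mu> i \<and> j' = \<mu> i' \<or>
      (i, j) \<in> F \<and> (i', j') \<in> F \<and> f i j = f i' j'"
    if eq: "K i j" "K i' j'" "c i j = c i' j'" for i i' j j'
  proof -
    have top: "int (2 * p - h - 1 + D) \<ge> int (p + D)" using hp h by linarith
    have range: "c i j \<ge> int (p + D) \<and> i = u \<and> j = p - h \<or> c i j = int p \<and> j = \<mu> i \<or>
        int p < c i j \<and> c i j < int (p + D) \<and> (i, j) \<in> F \<and> c i j = int (p + 1 + f i j)" if "K i j" for i j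
      using c_cases[OF that]
    proof (elim disjE conjE)
      assume "i = u" "j = p - h" "c i j = int (2 * p - h - 1 + D)"
      then show ?thesis using top by simp
    next
      assume "j = \<mu> i" "c i j = int p"
      then show ?thesis by simp
    next
      assume *: "(i, j) \<in> F" "c i j = int (p + 1 + f i j)" "f i j < D - 1"
      then have "int p < c i j" "c i j < int (p + D)" by linarith+
      with * show ?thesis by blast
    qed
    show ?thesis
    proof (cases "c i j \<ge> int (p + D)")
      case True
      then have "i = u \<and> j = p - h" "i' = u \<and> j' = p - h"
        using range[OF eq(1)] range[OF eq(2)] eq(3) pD hp by linarith+
      then show ?thesis by metis
    next
      case False
      show ?thesis
      proof (cases "c i j = int p")
        case True
        then have "j = \<mu> i" "j' = \<mu> i'"
          using range[OF eq(1)] range[OF eq(2)] eq(3) False by linarith+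
        then show ?thesis by metis
      next
        case p: False
        have "(i, j) \<in> F \<and> c i j = int (p + 1 + f i j)" "(i', j') \<in> F \<and> c i' j' = int (p + 1 + f i' j')"
          using range[OF eq(1)] range[OF eq(2)] eq(3) False p by linarith+
        then show ?thesis using eq(3) by simp
      qed
    qed
  qed
  have s_cases: "s t = int t + 1 \<and> t + 1 < h \<or> s t = int t \<and> h \<le> t \<and> t < p \<or>
      s t = int t + int D \<and> p \<le> t \<and> t + h + 1 < 2 * p \<or> s t = int t + int D - 1 \<and> 2 * p \<le> t + h"
    if "t \<notin> X" for t
  proof -
    have "t \<noteq> h - 1" "t \<noteq> 2 * p - h - 1" using that by (simp_all add: X_def)
    then have "t + 1 < h \<or> h \<le> t \<and> t < p \<or> p \<le> t \<and> t + h + 1 < 2 * p \<or> 2 * p \<le> t + h"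
      using hp h by linarith
    moreover have "t < 2 * p - h" if "t + h + 1 < 2 * p" using that by linarith
    ultimately show ?thesis using hp h pD by (elim disjE) (simp_all add: s_def)
  qed
  have s_mono: "s t < s t'" if "t \<notin> X" "t' \<notin> X" "t < t'" for t t'
  proof -
    have "h \<le> p" "D \<ge> 1" using hp pD by linarith+
    with s_cases[OF that(1)] s_cases[OF that(2)] that(3) show ?thesis
      by (elim disjE) linarith+
  qed
  have s_out: "s t < int p \<or> s t \<ge> int (p + D)" for t
    using hp h by (auto simp: s_def)

  \<comment> \<open>Verification of the conditions for the two-sided colouring\<close>
  have "deficiency V E \<le> int ((\<Sum>i<p. d (Left i)) + (\<Sum>j<p. d (Right j)) + d Apex)"
  proof (rule deficiency_le_two_sided[where h = h and X = X and s = s and pt = pt and lo = lo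
        and up = up and d = d and p = p and c = c and a = a and b = b,
        OF G _ P, folded K_def])
    show "r \<ge> 1" using r by simp
    show "pt x \<le> r" for x
      by (auto simp: pt_def split: vertex.split)
    show "card {x \<in> Left ` {..<p} \<union> Right ` {..<p} \<union> {Apex}. pt x = i} = (if i = r then 2 * h + 1 else 2 * h)" if ir: "i \<le> r" for i
    proof -
      define l where "l = (if i = r then r else r - 1 - i)"
      have l: "l \<le> r" by (simp add: l_def)
      have "pt (Left j) = i \<longleftrightarrow> j div h = r - i" if "j < p" for j
        using divr[OF that] ir unfolding pt_def vertex.case by linarith
      then have L: "{j. j < p \<and> pt (Left j) = i} = {j. j < (r + 1) * h \<and> j div h = r - i}"
        unfolding p_def[symmetric] by blast
      have "pt (Right j) = i \<longleftrightarrow> j div h = l" if "j < p" for j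
        using divr[OF that] ir r unfolding l_def pt_def vertex.case by (cases "j div h = r"; cases "i = r") (simp_all, linarith+)
      then have R: "{j. j < p \<and> pt (Right j) = i} = {j. j < (r + 1) * h \<and> j div h = l}"
        unfolding p_def[symmetric] by blast
      show ?thesis
        using card_block[of l "r + 1" h] card_block[of "r - i" "r + 1" h] l
        unfolding card_two_sided_part L R ptA by auto
    qed
    show "pt (Left i) = pt (Left j) \<and> pt (Right i) = pt (Right j)" if "i div h = j div h" for i j
      using that by (simp add: pt_def)
    show "i div h = j div h" if "i < p" "j < p" "i + j \<in> X" for i j
      using X[OF that(3,1,2)] div0[of i] div0[of j] div_last[of i] div_last[of j] that(1,2) by auto
    show "t = t'" if "t \<notin> X" "t' \<notin> X" "s t = s t'" for t t'
      using s_mono that by (metis less_irrefl nat_neq_iff)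
    show "j = j'" if "K i j" "K i j'" "c i j = c i j'" for i j j'
      using c_eqD[OF that] f(2)[of i j j'] by metis
    show "i = i'" if "K i j" "K i' j" "c i j = c i' j" for i i' j
      using c_eqD[OF that] f(3)[of i j i'] \<mu>_inj[of i i'] that(1,2) unfolding K_def by metis
    show "c i j \<noteq> s (i + k)" if "K i j" "k < p" "i + k \<notin> X" for i j k
      using c_cases[OF that(1)]
    proof (elim disjE conjE)
      \<comment> \<open>Label sums at \<open>Left u\<close> end at \<open>2 * p - h - 2\<close>, so
        its sum colours stay below the exceptional one.\<close>
      assume "i = u" "c i j = int (2 * p - h - 1 + D)"
      then show ?thesis using that u hp by (auto simp: s_def)
    qed (use s_out[of "i + k"] hp h pD in auto)
    show "c i j \<noteq> s (j + k)" if "K i j" "k < p" "j + k \<notin> X" for i j k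
      using c_cases[OF that(1)]
    proof (elim disjE conjE)
      \<comment> \<open>Only the largest label sum at \<open>Right (p - h)\<close>,
        \<open>2 * p - h - 1\<close>, could produce this colour, and it belongs to
        \<open>X\<close>.\<close>
      assume "j = p - h" "c i j = int (2 * p - h - 1 + D)"
      then show ?thesis using that hp h by (auto simp: s_def X_def)
    qed (use s_out[of "j + k"] hp h pD in auto)
    show "a i \<noteq> s (i + k)" if "i < p" "k < p" "i + k \<notin> X" for i k
    proof (cases "i = u")
      case True
      then show ?thesis using s_out[of "i + k"] hp h pD by (auto simp: a_def)
    next
      case False
      then show ?thesis using that hp h by (auto simp: a_def s_def X_def)
    qed
    show "b j \<noteq> s (j + k)" if "j < p" "pt (Right j) \<noteq> pt Apex" "k < p" for j k
    proof (cases "j < h")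
      case True
      then show ?thesis using that hp by (auto simp: s_def b_def)
    next
      case False
      moreover have "j < p - h" using that ptR[of j] ptA by simp
      ultimately have "f p j < D - 1" using f(1)[OF pF[of j]] by simp
      then show ?thesis using s_out[of "j + k"] False by (auto simp: b_def)
    qed
    show "a i \<noteq> c i j" if "K i j" for i j
    proof (cases "i = u")
      case True
      then show ?thesis using c_cases[OF that] \<mu>_u hp h pD by (auto simp: a_def)
    next
      case False
      then have "a i \<ge> int (p + D)" using hp h unfolding a_def by (simp; linarith)
      moreover have "c i j < int (p + D)" using c_cases[OF that] False pD hp h by auto
      ultimately show ?thesis by linarith
    qed
    show "b j \<noteq> c i j" if "K i j" "pt (Right j) \<noteq> pt Apex" for i j
    proof -
      have j: "j < p - h" "i \<noteq> p" using that ptR[of j] unfolding ptA by (auto simp: K_def)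
      show ?thesis
      proof (cases "j < h")
        case True
        then have "c i j < int (p + D)" using c_cases[OF that(1)] j pD hp by auto
        then show ?thesis using True by (simp add: b_def)
      next
        case False
        then have b: "b j = int (p + 1 + f p j)" by (simp add: b_def)
        have "f i j \<noteq> f p j" if "(i, j) \<in> F"
          using f(3)[OF that pF[of j]] j False by auto
        then show ?thesis using c_cases[OF that(1)] j unfolding b by auto
      qed
    qed
    show "i = i'" if "i < p" "i' < p" "pt (Left i) \<noteq> pt Apex" "pt (Left i') \<noteq> pt Apex" "a i = a i'" for i i'
    proof -
      have "h \<le> i" "h \<le> i'" using ptL ptA that(1-4) by (metis not_less)+
      then show ?thesis using that(5) u hp h pD by (auto simp: a_def split: if_splits)
    qed
    show "j = j'" if "j < p" "j' < p" "pt (Right j) \<noteq> pt Apex" "pt (Right j') \<noteq> pt Apex" "b j = b j'" for j j'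
      using that ptR[of j] ptR[of j'] f(1)[OF pF[of j]] f(1)[OF pF[of j']] f(2)[OF pF[of j] pF[of j']]
      by (auto simp: b_def ptA split: if_splits)
    show "a i \<noteq> b j" if "i < p" "j < p" "pt (Left i) \<noteq> pt Apex" "pt (Right j) \<noteq> pt Apex" for i j
    proof -
      have i: "h \<le> i" using ptL[OF that(1)] ptA that(3) by (metis not_less)
      have j: "j < p - h" using ptR[OF that(2)] ptA that(4) by (metis not_less)
      show ?thesis
      proof (cases "j < h")
        case True
        then show ?thesis using i u hp h pD by (auto simp: a_def b_def)
      next
        case False
        then have "f p j < D - 1" using f(1)[OF pF] j by simp
        moreover have "b j = int (p + 1 + f p j)" using False by (simp add: b_def)
        ultimately have "int p < b j" "b j < int (p + D)" by linarith+
        moreover have "a i \<ge> int (p + D) \<or> a i = int p" using i h hp unfolding a_def by (simp; linarith)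
        ultimately show ?thesis by linarith
      qed
    qed
    show "s (i + k) \<in> {lo (Left i)..<up (Left i)} \<inter> {lo (Right i)..<up (Right i)}" if "i < p" "k < p" "i + k \<notin> X" for i k
    proof -
      have hD: "h \<le> p" "D \<ge> 1" using hp pD by linarith+
      have lower: "int i \<le> s (i + k)" "i < h \<Longrightarrow> int (i + 1) \<le> s (i + k)"
        using s_cases[OF that(3)] hD by (elim disjE; linarith)+
      have upper: "s (i + k) < int (i + p + D)" "p - h < i \<Longrightarrow> s (i + k) < int (i + p + D - 1)"
        using s_cases[OF that(3)] hD that(2) by (elim disjE; linarith)+
      show ?thesis using lower upper by (auto simp: lo_def up_def)
    qed
    show "c i j \<in> {lo (Left i)..<up (Left i)} \<inter> {lo (Right j)..<up (Right j)}" if "K i j" for i j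
    proof (cases "i = u \<and> j = p - h")
      case True
      then have "c i j = int (2 * p - h - 1 + D)" by (simp add: c_def)
      with True show ?thesis using u hp h by (auto simp: lo_def up_def)
    next
      case False
      have ij: "i < p" "j < p" using that by (simp_all add: K_def)
      have "lo (Left i) \<le> int p" "lo (Right j) \<le> int p"
        using ij by (simp_all add: lo_def)
      moreover have "int (p + D) \<le> up (Left i)" "int (p + D) \<le> up (Right j)"
        using hp h by (simp_all add: up_def)
      moreover have "int p \<le> c i j"  "c i j < int (p + D)"
        using c_cases[OF that] False pD hp h by (elim disjE conjE; linarith)+
      ultimately show ?thesis by simp
    qed
    show "a i \<in> {lo (Left i)..<up (Left i)} \<inter> {lo Apex..<up Apex}" if "i < p" "pt (Left i) \<noteq> pt Apex" for i
      using that ptL[of i] u hp h pD by (auto simp: lo_def up_def a_def ptA)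
    show "b j \<in> {lo (Right j)..<up (Right j)} \<inter> {lo Apex..<up Apex}" if "j < p" "pt (Right j) \<noteq> pt Apex" for j
      using that ptR[of j] f(1)[OF pF[of j]] hp h pD by (auto simp: lo_def up_def b_def ptA)
    show "up x \<le> lo x + int (2 * h * r) + (if pt x = r then 0 else 1) + int (d x)"
      if "x \<in> Left ` {..<p} \<union> Right ` {..<p} \<union> {Apex}" for x
    proof -
      have nr': "int (2 * h * r) = int p + int D - 1" using nr by linarith
      show ?thesis
      proof (cases x)
        case (Left i)
        then show ?thesis using that ptL[of i] hp h unfolding nr' by (auto simp: up_def lo_def d_def)
      next
        case (Right j)
        then show ?thesis using that ptR[of j] hp h unfolding nr' by (auto simp: up_def lo_def d_def)
      next
        case Apex
        then show ?thesis using hp h unfolding nr' by (auto simp: up_def lo_def d_def ptA)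
      qed
    qed
  qed
  also have "(\<Sum>i<p. d (Left i)) = card ({..<p} \<inter> {i. h \<le> i \<and> i < p - h})"
    unfolding d_def vertex.case by (simp add: sum.If_cases)
  also have "{..<p} \<inter> {i. h \<le> i \<and> i < p - h} = {h..<p - h}" by auto
  also have "(\<Sum>j<p. d (Right j)) = card ({..<p} \<inter> {j. j = p - h})"
    unfolding d_def vertex.case by (simp add: sum.If_cases)
  also have "{..<p} \<inter> {j. j = p - h} = {p - h}" using hp h by auto
  also have "d Apex = 0" by (simp add: d_def)
  also have "card {h..<p - h} + card {p - h} + 0 = p - h - h + 1" by simp
  also have "p - h - h = h * (r - 1)"
    unfolding rh by (simp only: diff_mult_distrib2 mult.commute[of r h] mult_1_right)
  finally show ?thesis .
qed

theorem theorem10: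
  fixes n r :: nat and V :: "'a set" and E :: "'a set set" and P :: "nat \<Rightarrow> 'a set"
  assumes "n \<ge> 1" and "r \<ge> 1" and "even (n * (r + 1))"
    and "complete_multipartite V E (r + 1) P"
    and "\<forall>i<r. card (P i) = n" and "card (P r) = n + 1"
  shows "real n * (real r - 1) / 2 \<le> real_of_int (deficiency V E) \<and>
    real_of_int (deficiency V E) \<le> real n * (real r - 1) / 2 + 1"
proof -
  note G = assms(4) and P = assms(5)[rule_format] assms(6)
  have "int n * (int r - 1) \<le> 2 * deficiency V E"
    by (rule deficiency_lower_bound[OF G assms(3) P])
  then have "real_of_int (int n * (int r - 1)) \<le> real_of_int (2 * deficiency V E)"
    by (simp only: of_int_le_iff)
  then have lower: "real n * (real r - 1) / 2 \<le> real_of_int (deficiency V E)"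
    by simp
  \<comment> \<open>For odd \<open>r\<close> half of the \<open>r + 1\<close> parts go to each side,
    and the construction even meets the lower bound. For even \<open>r\<close> the parity hypothesis
    makes \<open>n\<close> even, so parts can be halved instead.\<close>
  have "2 * deficiency V E \<le> int n * (int r - 1) + 2"
  proof (cases "even r")
    case True
    then have "even n" using assms(3) by simp
    then obtain h where h: "n = 2 * h" by blast
    have "r \<ge> 2" using True assms(2) by (cases "r = 1") auto
    moreover have "h \<ge> 1" using h assms(1) by simp
    ultimately have "deficiency V E \<le> int (h * (r - 1) + 1)"
      using deficiency_upper_bound_even_size[OF G, of h] P h by simp
    then show ?thesis using assms(2) by (simp add: h of_nat_diff)
  next
    case False
    then obtain k where k: "r = 2 * k + 1" by (elim oddE)
    have "deficiency V E \<le> int (n * (k + 1 - 1))"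
      by (rule deficiency_upper_bound_even_parts[OF G assms(1) _ P]) (simp_all add: k)
    then show ?thesis by (simp add: k)
  qed
  then have "real_of_int (2 * deficiency V E) \<le> real_of_int (int n * (int r - 1) + 2)"
    by (simp only: of_int_le_iff)
  then have "real_of_int (deficiency V E) \<le> real n * (real r - 1) / 2 + 1"
    by simp
  with lower show ?thesis ..
qed

end
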